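(* Let $m\geq 0$ and $l\geq 0$ be integers, let $V$ be a real vector space of dimension $m+1$, and let $\mu_0,\ldots,\mu_l$ be Borel probability measures on the space $H^*$ of affine hyperplanes in $V$. If $l\leq m$, then there is a point $[e,x]\in H$ such that $$\mu_j\{[f,y]\in H^* \mid y f(e)\geq x f(e)^2\}\geq \tfrac12 \quad\text{and}\quad \mu_j\{[f,y]\in H^* \mid y f(e)\leq x f(e)^2\}\geq \tfrac12$$ for all $j=0,\ldots,l$.
   Context: $V$ is a finite-dimensional real vector space with its usual topology and $V^*$ is its dual. $H^*$ is the set of equivalence classes $[f,y]$ of pairs $(f,y)$ with $f\in V^*\setminus\{0\}$ and $y\in\mathbb{R}$, where $[f,y]=[tf,ty]$ for all $t\in\mathbb{R}^\times$; it has the quotient topology from $(V^*\setminus\{0\})\times\mathbb{R}$. The class $[f,y]$ corresponds to the affine hyperplane $\{v\in V\mid f(v)=y\}$ (so $H^*$ is the total space of the dual Hopf bundle over the real projective space $P(V^* )$). $H$ is the set of equivalence classes $[e,x]$ of pairs $(e,x)$ with $e\in V\setminus\{0\}$ and $x\in\mathbb{R}$, where $[e,x]=[te,x/t]$ for all $t\in\mathbb{R}^\times$ (the total space of the Hopf line bundle over $P(V)$); $[e,x]$ corresponds to the line $L=\mathbb{R}e$ through $0$ together with the point $v=xe\in L$. The pair of inequalities in the claim does not depend on the chosen representatives: replacing $(e,x)$ by $(te,x/t)$ with $t<0$ merely interchanges the two sets. *)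

theory Defs
  imports "HOL-Probability.Probability"
begin

definition hyperplane_rel ::
  "((('a::real_normed_vector \<Rightarrow>\<^sub>L real) \<times> real) \<times> (('a \<Rightarrow>\<^sub>L real) \<times> real)) set"
  where "hyperplane_rel = {((f, y), (t *\<^sub>R f, t * y)) | f y t. f \<noteq> 0 \<and> t \<noteq> 0}"

text \<open>For finite-dimensional \<open>'a\<close>, the type \<open>'a \<Rightarrow>\<^sub>L real\<close> contains every linear functional and its
  norm topology is the usual one, so it is the dual space. Representatives with zero functional
  are unrelated to everything; their class is empty and is not an element of the quotient.\<close>

definition hyperplane_space :: "(('a::real_normed_vector \<Rightarrow>\<^sub>L real) \<times> real) set set"
  where "hyperplane_space = {(f, y). f \<noteq> 0} // hyperplane_rel"

definition hyperplane_class ::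
  "('a::real_normed_vector \<Rightarrow>\<^sub>L real) \<Rightarrow> real \<Rightarrow> (('a \<Rightarrow>\<^sub>L real) \<times> real) set"
  where "hyperplane_class f y = hyperplane_rel `` {(f, y)}"

definition hyperplane_topology :: "(('a::real_normed_vector \<Rightarrow>\<^sub>L real) \<times> real) set topology"
  where "hyperplane_topology = topology (\<lambda>U. U \<subseteq> hyperplane_space \<and>
    openin (top_of_set {(f, y). f \<noteq> 0}) {(f, y). f \<noteq> 0 \<and> hyperplane_class f y \<in> U})"

definition borel_of :: "'b topology \<Rightarrow> 'b measure"
  where "borel_of X = sigma (topspace X) {U. openin X U}"

definition hopf_rel :: "(('a::real_normed_vector \<times> real) \<times> ('a \<times> real)) set"
  where "hopf_rel = {((e, x), (t *\<^sub>R e, x / t)) | e x t. e \<noteq> 0 \<and> t \<noteq> 0}"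

definition hopf_space :: "('a::real_normed_vector \<times> real) set set"
  where "hopf_space = {(e, x). e \<noteq> 0} // hopf_rel"

definition hopf_class :: "'a::real_normed_vector \<Rightarrow> real \<Rightarrow> ('a \<times> real) set"
  where "hopf_class e x = hopf_rel `` {(e, x)}"

lemma equiv_hyperplane_rel: "equiv {(f, y). f \<noteq> 0} hyperplane_rel"
proof (rule equivI)
  show "hyperplane_rel \<subseteq> {(f, y). f \<noteq> 0} \<times> {(f :: 'a \<Rightarrow>\<^sub>L real, y). f \<noteq> 0}"
    by (auto simp: hyperplane_rel_def)
  show "refl_on {(f, y). f \<noteq> 0} (hyperplane_rel :: ((('a \<Rightarrow>\<^sub>L real) \<times> real) \<times> _) set)"
    by (force simp: refl_on_def hyperplane_rel_def intro: exI[of _ 1])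
  show "sym (hyperplane_rel :: ((('a \<Rightarrow>\<^sub>L real) \<times> real) \<times> _) set)"
  proof (rule symI)
    fix p q :: "('a \<Rightarrow>\<^sub>L real) \<times> real"
    assume "(p, q) \<in> hyperplane_rel"
    then obtain f y t where "p = (f, y)" "q = (t *\<^sub>R f, t * y)" "f \<noteq> 0" "t \<noteq> 0"
      by (auto simp: hyperplane_rel_def)
    then show "(q, p) \<in> hyperplane_rel"
      unfolding hyperplane_rel_def
      by (auto intro!: exI[of _ "inverse t"])
  qed
  show "trans (hyperplane_rel :: ((('a \<Rightarrow>\<^sub>L real) \<times> real) \<times> _) set)"
  proof (rule transI)
    fix p q r :: "('a \<Rightarrow>\<^sub>L real) \<times> real"
    assume "(p, q) \<in> hyperplane_rel" "(q, r) \<in> hyperplane_rel"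
    then obtain f y s t where "p = (f, y)" "r = (t *\<^sub>R s *\<^sub>R f, t * (s * y))"
        "f \<noteq> 0" "s \<noteq> 0" "t \<noteq> 0"
      unfolding hyperplane_rel_def by blast
    then show "(p, r) \<in> hyperplane_rel"
      unfolding hyperplane_rel_def by (auto intro!: exI[of _ "t * s"])
  qed
qed

lemma equiv_hopf_rel: "equiv {(e, x). e \<noteq> 0} hopf_rel"
proof (rule equivI)
  show "hopf_rel \<subseteq> {(e, x). e \<noteq> 0} \<times> {(e :: 'a, x). e \<noteq> 0}"
    by (auto simp: hopf_rel_def)
  show "refl_on {(e, x). e \<noteq> 0} (hopf_rel :: (('a \<times> real) \<times> _) set)"
    by (force simp: refl_on_def hopf_rel_def intro: exI[of _ 1])
  show "sym (hopf_rel :: (('a \<times> real) \<times> _) set)"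
  proof (rule symI)
    fix p q :: "'a \<times> real"
    assume "(p, q) \<in> hopf_rel"
    then obtain e x t where "p = (e, x)" "q = (t *\<^sub>R e, x / t)" "e \<noteq> 0" "t \<noteq> 0"
      by (auto simp: hopf_rel_def)
    then show "(q, p) \<in> hopf_rel"
      unfolding hopf_rel_def
      by (auto intro!: exI[of _ "inverse t"])
  qed
  show "trans (hopf_rel :: (('a \<times> real) \<times> _) set)"
  proof (rule transI)
    fix p q r :: "'a \<times> real"
    assume "(p, q) \<in> hopf_rel" "(q, r) \<in> hopf_rel"
    then obtain e x s t where "p = (e, x)" "r = (t *\<^sub>R s *\<^sub>R e, x / s / t)"
        "e \<noteq> 0" "s \<noteq> 0" "t \<noteq> 0"
      unfolding hopf_rel_def by blast
    then show "(p, r) \<in> hopf_rel"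
      unfolding hopf_rel_def by (auto intro!: exI[of _ "t * s"] simp: mult.commute)
  qed
qed

lemma hyperplane_class_in_space_iff: "hyperplane_class f y \<in> hyperplane_space \<longleftrightarrow> f \<noteq> 0"
proof
  assume "hyperplane_class f y \<in> hyperplane_space"
  then have "hyperplane_class f y \<noteq> {}"
    unfolding hyperplane_space_def using in_quotient_imp_non_empty[OF equiv_hyperplane_rel] by blast
  then show "f \<noteq> 0"
    by (auto simp: hyperplane_class_def hyperplane_rel_def)
qed (auto simp: hyperplane_class_def hyperplane_space_def intro: quotientI)

lemma hopf_class_in_space_iff: "hopf_class e x \<in> hopf_space \<longleftrightarrow> e \<noteq> 0"
proof
  assume "hopf_class e x \<in> hopf_space"
  then have "hopf_class e x \<noteq> {}"
    unfolding hopf_space_def using in_quotient_imp_non_empty[OF equiv_hopf_rel] by blast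
  then show "e \<noteq> 0"
    by (auto simp: hopf_class_def hopf_rel_def)
qed (auto simp: hopf_class_def hopf_space_def intro: quotientI)

lemma openin_hyperplane_topology:
  "openin hyperplane_topology U \<longleftrightarrow> U \<subseteq> hyperplane_space \<and>
    openin (top_of_set {(f, y). f \<noteq> 0}) {(f, y). f \<noteq> 0 \<and> hyperplane_class f y \<in> U}"
proof -
  let ?T = "top_of_set {(f :: 'a \<Rightarrow>\<^sub>L real, y :: real). f \<noteq> 0}"
  let ?pre = "\<lambda>U. {(f :: 'a \<Rightarrow>\<^sub>L real, y). f \<noteq> 0 \<and> hyperplane_class f y \<in> U}"
  have "istopology (\<lambda>U. U \<subseteq> hyperplane_space \<and> openin ?T (?pre U))"
    unfolding istopology_def
  proof (intro conjI allI impI)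
    fix S U assume "S \<subseteq> hyperplane_space \<and> openin ?T (?pre S)"
      "U \<subseteq> hyperplane_space \<and> openin ?T (?pre U)"
    moreover have "?pre (S \<inter> U) = ?pre S \<inter> ?pre U" by auto
    ultimately show "S \<inter> U \<subseteq> hyperplane_space" "openin ?T (?pre (S \<inter> U))"
      by (auto simp del: openin_subtopology)
  next
    fix \<K> :: "(('a \<Rightarrow>\<^sub>L real) \<times> real) set set set"
    assume *: "\<forall>K\<in>\<K>. K \<subseteq> hyperplane_space \<and> openin ?T (?pre K)"
    then show "\<Union>\<K> \<subseteq> hyperplane_space" by blast
    have "?pre (\<Union>\<K>) = \<Union>(?pre ` \<K>)" by auto
    moreover have "openin ?T (\<Union>(?pre ` \<K>))"
      using * by (intro openin_Union) blast
    ultimately show "openin ?T (?pre (\<Union>\<K>))" by simp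
  qed
  then show ?thesis
    by (simp add: hyperplane_topology_def topology_inverse')
qed

lemma topspace_hyperplane_topology: "topspace hyperplane_topology = hyperplane_space"
proof -
  have "openin hyperplane_topology (hyperplane_space :: (('a \<Rightarrow>\<^sub>L real) \<times> real) set set)"
  proof -
    have "{(f, y). f \<noteq> 0 \<and> hyperplane_class f y \<in> hyperplane_space} =
        {(f :: 'a \<Rightarrow>\<^sub>L real, y). f \<noteq> 0}"
      by (auto simp: hyperplane_class_in_space_iff)
    then show ?thesis
      by (simp add: openin_hyperplane_topology)
  qed
  then show ?thesis
    by (metis openin_hyperplane_topology openin_subset openin_topspace subset_antisym)
qed

lemma quotient_map_hyperplane_class:
  "quotient_map (top_of_set {(f, y). f \<noteq> 0}) hyperplane_topology
    (\<lambda>(f, y). hyperplane_class f y)"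
proof -
  have "(\<lambda>(f, y). hyperplane_class f y) ` {(f, y). f \<noteq> 0} =
      (hyperplane_space :: (('a \<Rightarrow>\<^sub>L real) \<times> real) set set)"
    by (force simp: hyperplane_space_def hyperplane_class_def quotient_def)
  moreover have "{x \<in> {(f, y). f \<noteq> 0}. (\<lambda>(f, y). hyperplane_class f y) x \<in> U} =
      {(f :: 'a \<Rightarrow>\<^sub>L real, y). f \<noteq> 0 \<and> hyperplane_class f y \<in> U}" for U
    by auto
  ultimately show ?thesis
    unfolding quotient_map_def topspace_hyperplane_topology
    by (simp add: openin_hyperplane_topology del: openin_subtopology)
qed

end

theory Submission
  imports
    Defs
    "HOL-Homology.Invariance_of_Domain"
    "HOL-Real_Asymp.Real_Asymp"
begin

text \<open>A point \<open>[e, x]\<close> is a direction \<open>e\<close> together with a position \<open>x\<close> on the line spanned by \<open>e\<close>. If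
  the hyperplane \<open>[f, y]\<close> is not parallel to this line, it meets it at the position \<open>y / f e\<close>, and the
  two inequalities say that this position is at least, respectively at most, \<open>x\<close>; a hyperplane
  parallel to the line (\<open>f e = 0\<close>) satisfies both. So the assertion is
  that in some direction the random positions given by all the measures have a common median.

  If medians were unique and depended continuously on \<open>e\<close>, they would be odd functions of \<open>e\<close>, and so
  would the \<open>l \<le> m\<close> differences between the first and the others; by the Borsuk-Ulam theorem these have a common
  zero on the \<open>m\<close>-dimensional sphere of directions. In general they are neither unique nor continuous, so
  the sign of the deviation is replaced by a continuous approximation (\<open>squash\<close>). Instead of solving
  for the medians first, one unknown is added: Borsuk-Ulam is applied on the sphere of
  \<open>V \<times> \<real>\<close> to \<open>l + 1\<close> odd functions of direction and position together
  (\<open>exists_balanced_line\<close>). A limit argument turns approximate common medians into exact ones; if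
  the positions escape to infinity, then hyperplanes parallel to the limit line have at
  least half of every measure, and any position will do (\<open>exists_common_median\<close>).

  The Borsuk-Ulam theorem (\<open>Borsuk_Ulam_common_zero\<close>) follows from the fact that odd self-maps of spheres
  have odd degree (\<open>odd_sphere_degree\<close>). This is proved by induction on the dimension: an odd map is
  deformed through odd maps until it preserves an equator, and then its degree has the parity of the
  degree of its restriction to the equator, by a known computation in singular homology.\<close>

section \<open>Degrees of maps between coordinate spheres\<close>

text \<open>Brouwer degrees are defined for self-maps of \<open>nsphere n\<close>, which lives in \<open>nat \<Rightarrow> real\<close>, while
  the polynomial approximation and the dimension argument below take place in a Euclidean space.
  An enumeration of the standard basis connects the two, for the whole flag of spheres
  \<open>coord_sphere 0 \<subseteq> coord_sphere 1 \<subseteq> \<dots>\<close> of a single Euclidean space, so that an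
  induction on the dimension of the sphere stays inside one type.\<close>

definition bvec :: "nat \<Rightarrow> 'b::euclidean_space"
  where "bvec = (SOME b. bij_betw b {..<DIM('b)} Basis)"

definition coord_subspace :: "nat \<Rightarrow> 'b::euclidean_space set"
  where "coord_subspace n = {x. \<forall>i<DIM('b). n < i \<longrightarrow> x \<bullet> bvec i = 0}"

definition coord_sphere :: "nat \<Rightarrow> 'b::euclidean_space set"
  where "coord_sphere n = sphere 0 1 \<inter> coord_subspace n"

definition to_coords :: "'b::euclidean_space \<Rightarrow> nat \<Rightarrow> real"
  where "to_coords x = (\<lambda>i. if i < DIM('b) then x \<bullet> bvec i else 0)"

definition of_coords :: "(nat \<Rightarrow> real) \<Rightarrow> 'b::euclidean_space"
  where "of_coords u = (\<Sum>i<DIM('b). u i *\<^sub>R bvec i)"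

definition sphere_degree :: "nat \<Rightarrow> ('b::euclidean_space \<Rightarrow> 'b) \<Rightarrow> int"
  where "sphere_degree n f = Brouwer_degree2 n (to_coords \<circ> f \<circ> of_coords)"

lemma bij_betw_bvec: "bij_betw (bvec :: nat \<Rightarrow> 'b::euclidean_space) {..<DIM('b)} Basis"
proof -
  have "\<exists>b. bij_betw b {..<DIM('b)} (Basis :: 'b set)"
    by (metis atLeast0LessThan ex_bij_betw_nat_finite finite_Basis)
  then show ?thesis
    unfolding bvec_def by (rule someI_ex)
qed

lemma bvec_in_Basis: "i < DIM('b) \<Longrightarrow> (bvec i :: 'b::euclidean_space) \<in> Basis"
  using bij_betw_bvec bij_betwE by blast

lemma inner_bvec:
  assumes "i < DIM('b)" "j < DIM('b)"
  shows "(bvec i :: 'b::euclidean_space) \<bullet> bvec j = (if i = j then 1 else 0)"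
proof -
  have "inj_on (bvec :: nat \<Rightarrow> 'b) {..<DIM('b)}"
    using bij_betw_bvec bij_betw_imp_inj_on by blast
  then show ?thesis
    using assms by (auto simp: inner_Basis bvec_in_Basis inj_on_eq_iff)
qed

lemma sum_Basis_bvec:
  "(\<Sum>b\<in>Basis. g b) = (\<Sum>i<DIM('b). g (bvec i :: 'b::euclidean_space))"
  by (rule sum.reindex_bij_betw[OF bij_betw_bvec, symmetric])

lemma of_to_coords: "of_coords (to_coords x) = x"
proof -
  have "of_coords (to_coords x) = (\<Sum>i<DIM('a). (x \<bullet> bvec i) *\<^sub>R (bvec i :: 'a))"
    unfolding of_coords_def to_coords_def by (intro sum.cong) auto
  also have "\<dots> = x"
    using sum_Basis_bvec[of "\<lambda>b. (x \<bullet> b) *\<^sub>R b"] by (simp add: euclidean_representation)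
  finally show ?thesis .
qed

lemma inner_of_coords:
  "i < DIM('b) \<Longrightarrow> (of_coords u :: 'b::euclidean_space) \<bullet> bvec i = u i"
  by (simp add: of_coords_def inner_sum_left inner_bvec if_distrib sum.delta cong: if_cong)

lemma to_of_coords:
  assumes "\<And>i. i \<ge> DIM('b) \<Longrightarrow> u i = 0"
  shows "to_coords (of_coords u :: 'b::euclidean_space) = u"
  by (rule ext) (auto simp: to_coords_def inner_of_coords assms)

lemma norm_bvec_sum: "(norm (x :: 'b::euclidean_space))\<^sup>2 = (\<Sum>i<DIM('b). (x \<bullet> bvec i)\<^sup>2)"
proof -
  have "(norm x)\<^sup>2 = (\<Sum>b\<in>Basis. (x \<bullet> b)\<^sup>2)"
    unfolding power2_norm_eq_inner by (subst euclidean_inner) (simp add: power2_eq_square)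
  then show ?thesis
    using sum_Basis_bvec[of "\<lambda>b. (x \<bullet> b)\<^sup>2"] by simp
qed

lemma subspace_coord_subspace: "subspace (coord_subspace n)"
  by (auto simp: subspace_def coord_subspace_def inner_add_left)

lemma coord_subspace_mono: "m \<le> n \<Longrightarrow> coord_subspace m \<subseteq> coord_subspace n"
  by (auto simp: coord_subspace_def)

lemma dim_coord_subspace:
  assumes "n < DIM('b)"
  shows "dim (coord_subspace n :: 'b::euclidean_space set) = Suc n"
proof -
  have inj: "inj_on (bvec :: nat \<Rightarrow> 'b) {..<DIM('b)}"
    using bij_betw_bvec bij_betw_imp_inj_on by blast
  have "(coord_subspace n :: 'b set) =
      {x. \<forall>b\<in>Basis. b \<notin> bvec ` {..n} \<longrightarrow> x \<bullet> b = 0}"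
  proof -
    have "Basis = (bvec :: nat \<Rightarrow> 'b) ` {..<DIM('b)}"
      using bij_betw_bvec bij_betw_imp_surj_on by blast
    moreover have "(bvec i :: 'b) \<in> bvec ` {..n} \<longleftrightarrow> i \<le> n" if "i < DIM('b)" for i
      using inj_onD[OF inj, of i] that assms by fastforce
    ultimately show ?thesis
      by (fastforce simp: coord_subspace_def not_le)
  qed
  moreover have "card ((bvec :: nat \<Rightarrow> 'b) ` {..n}) = Suc n"
    using card_image[OF inj_on_subset[OF inj, of "{..n}"]] assms by (simp add: subset_eq)
  moreover have "(bvec :: nat \<Rightarrow> 'b) ` {..n} \<subseteq> Basis"
    using assms by (auto intro!: bvec_in_Basis)
  ultimately show ?thesis
    by (simp add: dim_substandard)
qed

lemma to_coords_sphere: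
  assumes "n < DIM('b)" "(x :: 'b::euclidean_space) \<in> coord_sphere n"
  shows "to_coords x \<in> topspace (nsphere n)"
proof -
  have "(\<Sum>i\<le>n. (to_coords x i)\<^sup>2) = (\<Sum>i<DIM('b). (x \<bullet> bvec i)\<^sup>2)"
    using assms by (intro sum.mono_neutral_cong_left)
      (auto simp: to_coords_def coord_sphere_def coord_subspace_def not_le)
  then have "(\<Sum>i\<le>n. (to_coords x i)\<^sup>2) = 1"
    using assms by (simp add: norm_bvec_sum[symmetric] coord_sphere_def)
  then show ?thesis
    using assms by (auto simp: nsphere to_coords_def coord_sphere_def coord_subspace_def)
qed

lemma nsphere_vanish: "u \<in> topspace (nsphere n) \<Longrightarrow> n < i \<Longrightarrow> u i = 0"
  by (auto simp: nsphere)

lemma of_coords_sphere: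
  assumes "n < DIM('b)" "u \<in> topspace (nsphere n)"
  shows "(of_coords u :: 'b::euclidean_space) \<in> coord_sphere n"
proof -
  have "(\<Sum>i\<le>n. (u i)\<^sup>2) = (\<Sum>i<DIM('b). (u i)\<^sup>2)"
    using assms by (intro sum.mono_neutral_cong_left) (auto simp: not_le nsphere)
  moreover have "(\<Sum>i\<le>n. (u i)\<^sup>2) = 1"
    using assms by (simp add: nsphere)
  ultimately have "(norm (of_coords u :: 'b))\<^sup>2 = 1"
    by (simp add: norm_bvec_sum inner_of_coords)
  then have "norm (of_coords u :: 'b) = 1"
    by (simp add: power2_eq_1_iff)
      (metis abs_norm_cancel abs_1 abs_minus_cancel)
  then show ?thesis
    using assms by (auto simp: coord_sphere_def coord_subspace_def inner_of_coords nsphere_vanish)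
qed

lemma to_of_coords_sphere:
  assumes "n < DIM('b)" "u \<in> topspace (nsphere n)"
  shows "to_coords (of_coords u :: 'b::euclidean_space) = u"
  using assms by (intro to_of_coords) (auto intro: nsphere_vanish)

lemma nsphere_eq_top_of_set: "nsphere n = top_of_set (topspace (nsphere n))"
  by (simp add: nsphere euclidean_product_topology)

lemma continuous_map_to_coords:
  assumes "n < DIM('b)"
  shows "continuous_map (top_of_set (coord_sphere n :: 'b::euclidean_space set)) (nsphere n) to_coords"
proof -
  have "continuous_on (coord_sphere n :: 'b set) to_coords"
    unfolding to_coords_def
  proof (rule continuous_on_coordinatewise_then_product)
    show "continuous_on (coord_sphere n :: 'b set) (\<lambda>x. if i < DIM('b) then x \<bullet> bvec i else 0)" for i
      by (cases "i < DIM('b)") (auto intro!: continuous_intros)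
  qed
  then show ?thesis
    by (subst nsphere_eq_top_of_set) (auto simp: assms to_coords_sphere)
qed

lemma continuous_map_of_coords:
  assumes "n < DIM('b)"
  shows "continuous_map (nsphere n) (top_of_set (coord_sphere n :: 'b::euclidean_space set)) of_coords"
proof -
  have "continuous_on (topspace (nsphere n)) (of_coords :: _ \<Rightarrow> 'b)"
    unfolding of_coords_def
    by (intro continuous_intros continuous_on_product_coordinates)
      (auto intro: continuous_on_subset[OF continuous_on_product_coordinates])
  then show ?thesis
    by (subst nsphere_eq_top_of_set) (auto simp: assms of_coords_sphere)
qed

lemma continuous_map_coords:
  assumes "n < DIM('b)" "continuous_on (coord_sphere n) f" "f \<in> coord_sphere n \<rightarrow> coord_sphere n"
  shows "continuous_map (nsphere n) (nsphere n) (to_coords \<circ> (f :: 'b::euclidean_space \<Rightarrow> 'b) \<circ> of_coords)"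
proof -
  have "continuous_map (top_of_set (coord_sphere n)) (top_of_set (coord_sphere n)) f"
    using assms by auto
  with assms(1) show ?thesis
    by (intro continuous_map_compose[OF continuous_map_of_coords]
        continuous_map_compose[OF _ continuous_map_to_coords])
qed

lemma sphere_degree_cong:
  assumes "n < DIM('b)" "\<And>x. x \<in> coord_sphere n \<Longrightarrow> f x = (g x :: 'b::euclidean_space)"
  shows "sphere_degree n f = sphere_degree n g"
  unfolding sphere_degree_def
  by (intro Brouwer_degree2_eq) (simp add: assms of_coords_sphere)

lemma sphere_degree_compose:
  assumes "n < DIM('b)"
    and "continuous_on (coord_sphere n) f" "f \<in> coord_sphere n \<rightarrow> coord_sphere n"
    and "continuous_on (coord_sphere n) g" "g \<in> coord_sphere n \<rightarrow> coord_sphere n"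
  shows "sphere_degree n (g \<circ> (f :: 'b::euclidean_space \<Rightarrow> 'b)) = sphere_degree n g * sphere_degree n f"
proof -
  have "sphere_degree n (g \<circ> f) =
      Brouwer_degree2 n ((to_coords \<circ> g \<circ> of_coords) \<circ> (to_coords \<circ> f \<circ> of_coords))"
    unfolding sphere_degree_def by (simp add: o_def of_to_coords)
  also have "\<dots> = sphere_degree n g * sphere_degree n f"
    unfolding sphere_degree_def using assms
    by (intro Brouwer_degree2_compose continuous_map_coords)
  finally show ?thesis .
qed

lemma sphere_degree_nonsurjective:
  assumes "n < DIM('b)" "continuous_on (coord_sphere n) f" "f \<in> coord_sphere n \<rightarrow> coord_sphere n"
    and "v \<in> coord_sphere n" "v \<notin> f ` coord_sphere n"
  shows "sphere_degree n (f :: 'b::euclidean_space \<Rightarrow> 'b) = 0"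
  unfolding sphere_degree_def
proof (rule Brouwer_degree2_nonsurjective)
  show "continuous_map (nsphere n) (nsphere n) (to_coords \<circ> f \<circ> of_coords)"
    using assms by (intro continuous_map_coords)
  have "to_coords v \<notin> (to_coords \<circ> f \<circ> of_coords) ` topspace (nsphere n)"
  proof
    assume "to_coords v \<in> (to_coords \<circ> f \<circ> of_coords) ` topspace (nsphere n)"
    then obtain u where "u \<in> topspace (nsphere n)" "to_coords v = to_coords (f (of_coords u))"
      by auto
    then show False
      using assms(1,5) of_coords_sphere of_to_coords by (metis image_eqI)
  qed
  then show "(to_coords \<circ> f \<circ> of_coords) ` topspace (nsphere n) \<noteq> topspace (nsphere n)"
    using to_coords_sphere assms(1,4) by blast
qed

lemma sgn_in_coord_sphere:
  "x \<in> coord_subspace n \<Longrightarrow> x \<noteq> 0 \<Longrightarrow> sgn x \<in> coord_sphere n"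
  by (simp add: coord_sphere_def norm_sgn sgn_div_norm subspace_scale subspace_coord_subspace)

lemma sgn_coord_sphere [simp]: "x \<in> coord_sphere n \<Longrightarrow> sgn x = x"
  by (simp add: coord_sphere_def sgn_div_norm)

lemma sphere_degree_homotopy:
  fixes F :: "real \<Rightarrow> 'b::euclidean_space \<Rightarrow> 'b"
  assumes "n < DIM('b)"
    and "continuous_on ({0..1} \<times> coord_sphere n) (\<lambda>(t, x). F t x)"
    and "\<And>t x. t \<in> {0..1} \<Longrightarrow> x \<in> coord_sphere n \<Longrightarrow> F t x \<in> coord_subspace n \<and> F t x \<noteq> 0"
  shows "sphere_degree n (\<lambda>x. sgn (F 0 x)) = sphere_degree n (\<lambda>x. sgn (F 1 x))"
proof -
  have "continuous_on ({0..1} \<times> coord_sphere n) (\<lambda>z. sgn (F (fst z) (snd z)))"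
    using assms by (intro continuous_on_sgn) (auto simp: case_prod_unfold)
  then have "homotopic_with_canon (\<lambda>_. True) (coord_sphere n) (coord_sphere n)
      (\<lambda>x. sgn (F 0 x)) (\<lambda>x. sgn (F 1 x))"
    unfolding homotopic_with_def using assms
    by (intro exI[of _ "\<lambda>z. sgn (F (fst z) (snd z))"])
       (auto simp: sgn_in_coord_sphere)
  then have "homotopic_with (\<lambda>_. True) (nsphere n) (nsphere n)
      (to_coords \<circ> ((\<lambda>x. sgn (F 0 x)) \<circ> of_coords)) (to_coords \<circ> ((\<lambda>x. sgn (F 1 x)) \<circ> of_coords))"
    using assms(1)
    by (intro homotopic_with_compose_continuous_map_left[OF _ continuous_map_to_coords]
        homotopic_with_compose_continuous_map_right[OF _ continuous_map_of_coords]) auto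
  then show ?thesis
    unfolding sphere_degree_def comp_assoc by (rule Brouwer_degree2_homotopic)
qed

text \<open>This is the step of the induction on dimension: the homological input that the parity of the
  degree of an odd map does not change on passing to an invariant equator.\<close>

lemma sphere_degree_odd_step:
  fixes f :: "'b::euclidean_space \<Rightarrow> 'b"
  assumes "Suc n < DIM('b)"
    and "continuous_on (coord_sphere (Suc n)) f" "f \<in> coord_sphere (Suc n) \<rightarrow> coord_sphere (Suc n)"
    and "\<And>x. x \<in> coord_sphere (Suc n) \<Longrightarrow> f (- x) = - f x"
    and "f \<in> coord_sphere n \<rightarrow> coord_sphere n"
  shows "even (sphere_degree (Suc n) f - sphere_degree n f)"
proof -
  have neg: "of_coords (\<lambda>i. - u i) = - (of_coords u :: 'b)" for u
    by (simp add: of_coords_def sum_negf)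
  have "even (Brouwer_degree2 (Suc n) (to_coords \<circ> f \<circ> of_coords)
      - Brouwer_degree2 (Suc n - Suc 0) (to_coords \<circ> f \<circ> of_coords))"
  proof (rule Borsuk_odd_mapping_degree_step)
    show "continuous_map (nsphere (Suc n)) (nsphere (Suc n)) (to_coords \<circ> f \<circ> of_coords)"
      using assms by (intro continuous_map_coords)
    show "(to_coords \<circ> f \<circ> of_coords \<circ> (\<lambda>x i. - x i)) u = ((\<lambda>x i. - x i) \<circ> (to_coords \<circ> f \<circ> of_coords)) u"
      if "u \<in> topspace (nsphere (Suc n))" for u
      using of_coords_sphere[OF assms(1) that] assms(4) neg by (auto simp: to_coords_def)
    show "to_coords \<circ> f \<circ> of_coords
        \<in> topspace (nsphere (Suc n - Suc 0)) \<rightarrow> topspace (nsphere (Suc n - Suc 0))"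
      using assms(1,5) by (auto intro!: to_coords_sphere of_coords_sphere simp: Pi_iff)
  qed
  then show ?thesis
    by (simp add: sphere_degree_def)
qed

section \<open>Odd maps have odd degree\<close>

text \<open>For \<open>w = 0\<close> the division by zero makes this the identity, so the reflection that exchanges two
  vectors of equal norm needs no exception for equal vectors.\<close>

definition hyperplane_reflection :: "'b::real_inner \<Rightarrow> 'b \<Rightarrow> 'b"
  where "hyperplane_reflection w x = x - (2 * (x \<bullet> w) / (w \<bullet> w)) *\<^sub>R w"

lemma norm_hyperplane_reflection [simp]: "norm (hyperplane_reflection w x) = norm x"
proof (cases "w = 0")
  case False
  then have "hyperplane_reflection w x \<bullet> hyperplane_reflection w x = x \<bullet> x"
    by (simp add: hyperplane_reflection_def inner_diff_left inner_diff_right inner_commute field_simps)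
  then show ?thesis by (simp add: norm_eq_sqrt_inner)
qed (simp add: hyperplane_reflection_def)

lemma hyperplane_reflection_maps:
  assumes "norm v = norm u"
  shows "hyperplane_reflection (v - u) v = u"
proof (cases "v = u")
  case False
  have "v \<bullet> v = u \<bullet> u"
    using assms by (simp add: norm_eq)
  then have "(v - u) \<bullet> (v - u) = 2 * (v \<bullet> (v - u))"
    by (simp add: inner_diff_left inner_diff_right inner_commute)
  moreover have "(v - u) \<bullet> (v - u) \<noteq> 0"
    using False by simp
  ultimately show ?thesis
    by (simp add: hyperplane_reflection_def)
qed (simp add: hyperplane_reflection_def)

lemma hyperplane_reflection_minus: "hyperplane_reflection w (- x) = - hyperplane_reflection w x"
  by (simp add: hyperplane_reflection_def)

lemma hyperplane_reflection_involution: "hyperplane_reflection w (hyperplane_reflection w x) = x"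
proof (cases "w = 0")
  case False
  then show ?thesis
    by (simp add: hyperplane_reflection_def inner_diff_left scaleR_diff_left[symmetric] algebra_simps)
qed (simp add: hyperplane_reflection_def)

lemma bvec_coord_sphere: "n < DIM('b) \<Longrightarrow> (bvec n :: 'b::euclidean_space) \<in> coord_sphere n"
  by (auto simp: coord_sphere_def coord_subspace_def inner_bvec bvec_in_Basis norm_Basis)

lemma uminus_coord_sphere: "x \<in> coord_sphere n \<Longrightarrow> - x \<in> coord_sphere n"
  by (auto simp: coord_sphere_def coord_subspace_def)

lemma coord_sphere_mono: "m \<le> n \<Longrightarrow> coord_sphere m \<subseteq> coord_sphere n"
  unfolding coord_sphere_def using coord_subspace_mono by blast

lemma compact_coord_sphere: "compact (coord_sphere n)"
  unfolding coord_sphere_def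
  by (intro compact_Int_closed closed_subspace subspace_coord_subspace) auto

lemma coord_subspace_Suc:
  assumes "Suc n < DIM('b)"
  shows "(x :: 'b::euclidean_space) \<in> coord_subspace n \<longleftrightarrow>
    x \<in> coord_subspace (Suc n) \<and> x \<bullet> bvec (Suc n) = 0"
  using assms by (auto simp: coord_subspace_def) (metis Suc_lessI)

lemma coord_sphere_0:
  assumes "(x :: 'b::euclidean_space) \<in> coord_sphere 0"
  shows "x = bvec 0 \<or> x = - bvec 0"
proof -
  define u where "u = to_coords x"
  have u: "u \<in> topspace (nsphere 0)"
    unfolding u_def using assms by (intro to_coords_sphere) auto
  then have "u 0 = 1 \<or> u 0 = - 1"
    by (simp add: nsphere power2_eq_1_iff)
  moreover have "x = (\<Sum>i<DIM('b). if i = 0 then u 0 *\<^sub>R bvec i else 0)"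
  proof -
    have "x = of_coords u" by (simp add: u_def of_to_coords)
    also have "\<dots> = (\<Sum>i<DIM('b). if i = 0 then u 0 *\<^sub>R bvec i else 0)"
      unfolding of_coords_def using nsphere_vanish[OF u] by (intro sum.cong) auto
    finally show ?thesis .
  qed
  ultimately show ?thesis
    by auto
qed

lemma odd_sphere_degree_0:
  fixes f :: "'b::euclidean_space \<Rightarrow> 'b"
  assumes "f \<in> coord_sphere 0 \<rightarrow> coord_sphere 0"
    and "\<And>x. x \<in> coord_sphere 0 \<Longrightarrow> f (- x) = - f x"
  shows "odd (sphere_degree 0 f)"
proof -
  have 0: "0 < DIM('b)" by simp
  have b: "(bvec 0 :: 'b) \<in> coord_sphere 0"
    by (rule bvec_coord_sphere) simp
  consider "f (bvec 0) = bvec 0" | "f (bvec 0) = - bvec 0"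
    using assms(1) b coord_sphere_0 by blast
  then show ?thesis
  proof cases
    case 1
    then have "f x = id x" if "x \<in> coord_sphere 0" for x
      using coord_sphere_0[OF that] assms(2)[OF b] by auto
    then have "sphere_degree 0 f = sphere_degree 0 (id :: 'b \<Rightarrow> 'b)"
      by (intro sphere_degree_cong) auto
    also have "\<dots> = Brouwer_degree2 0 id"
      unfolding sphere_degree_def
      by (intro Brouwer_degree2_eq) (simp add: to_of_coords_sphere[OF 0])
    finally show ?thesis by simp
  next
    case 2
    then have "f x = - x" if "x \<in> coord_sphere 0" for x
      using coord_sphere_0[OF that] assms(2)[OF b] by auto
    then have "sphere_degree 0 f = sphere_degree 0 (uminus :: 'b \<Rightarrow> 'b)"
      by (intro sphere_degree_cong) auto
    also have "\<dots> = Brouwer_degree2 0 (\<lambda>x i. if i = 0 then - x i else x i)"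
      unfolding sphere_degree_def
    proof (intro Brouwer_degree2_eq ext)
      fix u :: "nat \<Rightarrow> real" and i assume u: "u \<in> topspace (nsphere 0)"
      have "- (of_coords u :: 'b) = of_coords (\<lambda>i. - u i)"
        by (simp add: of_coords_def sum_negf)
      then show "(to_coords \<circ> (uminus :: 'b \<Rightarrow> 'b) \<circ> of_coords) u i = (if i = 0 then - u i else u i)"
        using nsphere_vanish[OF u, of i] by (auto simp: to_coords_def inner_of_coords)
    qed
    finally show ?thesis by (simp add: Brouwer_degree2_reflection)
  qed
qed

text \<open>An odd map of spheres need not carry the equator into the equator, and the image of the
  equator may even fill the whole sphere. A smooth map cannot do the latter for reasons of dimension,
  so the map is replaced by the odd part of a polynomial approximation. The approximation is closer
  to the map than the origin is, hence the segment between them avoids the origin and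
  normalizing it gives a homotopy. As the new map is odd, its restriction to the equator misses some
  point together with its antipode.\<close>

lemma odd_map_homotopic_missing_axis:
  fixes f :: "'b::euclidean_space \<Rightarrow> 'b"
  assumes n: "Suc n < DIM('b)"
    and f: "continuous_on (coord_sphere (Suc n)) f" "f \<in> coord_sphere (Suc n) \<rightarrow> coord_sphere (Suc n)"
      "\<And>x. x \<in> coord_sphere (Suc n) \<Longrightarrow> f (- x) = - f x"
  obtains p :: "'b \<Rightarrow> 'b" and v where "continuous_on (coord_sphere (Suc n)) p"
    "p \<in> coord_sphere (Suc n) \<rightarrow> coord_sphere (Suc n)"
    "\<And>x. x \<in> coord_sphere (Suc n) \<Longrightarrow> p (- x) = - p x"
    "sphere_degree (Suc n) p = sphere_degree (Suc n) f"
    "v \<in> coord_sphere (Suc n)" "v \<notin> p ` coord_sphere n" "- v \<notin> p ` coord_sphere n"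
proof -
  let ?S = "coord_sphere (Suc n) :: 'b set" and ?T = "coord_subspace (Suc n) :: 'b set"
  have sT: "subspace ?T" by (rule subspace_coord_subspace)
  obtain g where g: "polynomial_function g" "g ` ?S \<subseteq> ?T" "\<And>x. x \<in> ?S \<Longrightarrow> norm (f x - g x) < 1"
  proof (rule Stone_Weierstrass_polynomial_function_subspace[OF compact_coord_sphere f(1) zero_less_one sT])
    show "f ` ?S \<subseteq> ?T" using f(2) by (auto simp: coord_sphere_def)
  qed blast
  define h where "h x = (1/2) *\<^sub>R (g x - g (- x))" for x
  have hT: "h x \<in> ?T" if "x \<in> ?S" for x
    unfolding h_def using that g(2) uminus_coord_sphere[OF that]
    by (intro subspace_scale subspace_diff sT) auto
  have hf: "norm (h x - f x) < 1" if "x \<in> ?S" for x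
  proof -
    have "h x - f x = (1/2) *\<^sub>R (f (- x) - g (- x)) - (1/2) *\<^sub>R (f x - g x)"
      using f(3)[OF that] by (simp add: h_def algebra_simps flip: scaleR_add_left)
    then have "norm (h x - f x) \<le> (1/2) * norm (f (- x) - g (- x)) + (1/2) * norm (f x - g x)"
      by (metis (no_types, opaque_lifting) abs_of_nonneg divide_nonneg_nonneg norm_scaleR norm_triangle_ineq4 zero_le_numeral zero_le_one)
    then show ?thesis
      using g(3)[OF that] g(3)[OF uminus_coord_sphere[OF that]] by linarith
  qed
  have hdiff: "h differentiable (at x)" for x
  proof -
    have "polynomial_function (\<lambda>x. g (- x))"
      using polynomial_function_compose[OF polynomial_function_minus[OF polynomial_function_id] g(1)]
      by (simp add: o_def)
    then show ?thesis
      unfolding h_def using g(1)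
      by (intro differentiable_at_polynomial_function polynomial_function_cmul polynomial_function_diff)
  qed
  define F where "F t x = (1 - t) *\<^sub>R f x + t *\<^sub>R h x" for t x
  have F0: "F t x \<in> ?T \<and> F t x \<noteq> 0" if "t \<in> {0..1}" "x \<in> ?S" for t x
  proof
    have "f x \<in> ?S" using f(2) that by auto
    then show "F t x \<in> ?T"
      unfolding F_def using hT[OF that(2)]
      by (intro subspace_add subspace_scale sT) (auto simp: coord_sphere_def)
    have "norm (F t x - f x) = t * norm (h x - f x)"
    proof -
      have "F t x - f x = t *\<^sub>R (h x - f x)"
        by (simp add: F_def algebra_simps)
      then show ?thesis using that(1) by simp
    qed
    also have "\<dots> < 1"
      using hf[OF that(2)] that(1) by (cases "t = 0") (auto intro: mult_le_one le_less_trans[OF mult_left_le_one_le])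
    finally show "F t x \<noteq> 0"
      using \<open>f x \<in> ?S\<close> by (auto simp: coord_sphere_def)
  qed
  have hcont: "continuous_on A h" for A
    using hdiff by (meson continuous_at_imp_continuous_on differentiable_imp_continuous_within)
  have h0: "h x \<noteq> 0" if "x \<in> ?S" for x
    using F0[of 1 x] that by (simp add: F_def)
  define p where "p x = sgn (h x)" for x
  have pS: "p \<in> ?S \<rightarrow> ?S"
    unfolding p_def using hT h0 by (auto intro: sgn_in_coord_sphere)
  have pm: "p (- x) = - p x" for x
    unfolding p_def h_def by (simp add: sgn_div_norm norm_minus_commute flip: scaleR_minus_right)
  have SS: "coord_sphere n \<subseteq> ?S" by (rule coord_sphere_mono) simp
  have pdiff: "p differentiable_on (sphere 0 1 \<inter> coord_subspace n)"
    unfolding differentiable_on_def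
  proof
    fix x :: 'b assume "x \<in> sphere 0 1 \<inter> coord_subspace n"
    then have "h x \<noteq> 0" using h0 SS by (auto simp: coord_sphere_def)
    then have "p differentiable (at x)"
      unfolding p_def sgn_div_norm using hdiff
      by (intro derivative_intros differentiable_compose[OF differentiable_norm_at]) auto
    then show "p differentiable (at x within sphere 0 1 \<inter> coord_subspace n)"
      by (rule differentiable_at_withinI)
  qed
  have "p ` coord_sphere n \<noteq> ?S"
    unfolding coord_sphere_def
  proof (rule spheremap_lemma1[OF _ _ _ _ pdiff])
    show "dim (coord_subspace n :: 'b set) < dim ?T"
      using n by (simp add: dim_coord_subspace)
  qed (use coord_subspace_mono[of n "Suc n"] in \<open>auto simp: subspace_coord_subspace\<close>)
  moreover have "p ` coord_sphere n \<subseteq> ?S" using pS SS by blast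
  ultimately obtain v where v: "v \<in> ?S" "v \<notin> p ` coord_sphere n" by blast
  have "- v \<notin> p ` coord_sphere n"
  proof
    assume "- v \<in> p ` coord_sphere n"
    then obtain x where "x \<in> coord_sphere n" "- v = p x" by auto
    then have "v = p (- x)" "- x \<in> coord_sphere n"
      using pm by (metis minus_minus, auto simp: uminus_coord_sphere)
    then show False using v(2) by blast
  qed
  moreover have "sphere_degree (Suc n) p = sphere_degree (Suc n) f"
  proof -
    have "continuous_on ({0..1} \<times> ?S) (\<lambda>(t, x). F t x)"
      unfolding F_def case_prod_unfold
      by (intro continuous_intros continuous_on_compose2[OF f(1)] continuous_on_compose2[OF hcont]) auto
    then have "sphere_degree (Suc n) (\<lambda>x. sgn (F 0 x)) = sphere_degree (Suc n) (\<lambda>x. sgn (F 1 x))"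
      using n F0 by (intro sphere_degree_homotopy) auto
    moreover have "sphere_degree (Suc n) (\<lambda>x. sgn (F 0 x)) = sphere_degree (Suc n) f"
      using n f(2) by (intro sphere_degree_cong) (auto simp: F_def Pi_iff)
    ultimately show ?thesis by (simp add: F_def p_def[abs_def])
  qed
  moreover have "continuous_on ?S p"
    unfolding p_def using h0 by (intro continuous_on_sgn hcont) auto
  ultimately show thesis
    using pS pm v by (intro that[of p v])
qed

text \<open>Borsuk's odd mapping theorem. After the preceding replacement, a reflection moves the axis that
  the equator misses to the last coordinate axis. Projecting along this axis is then possible over
  the equator, and fading the projection out towards the poles gives an odd homotopy to a map that
  preserves the equator, to which the induction hypothesis applies. The degree of the reflection
  need not be computed: if a product is odd, so is each of its factors.\<close>

theorem odd_sphere_degree: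
  fixes f :: "'b::euclidean_space \<Rightarrow> 'b"
  assumes "n < DIM('b)" "continuous_on (coord_sphere n) f" "f \<in> coord_sphere n \<rightarrow> coord_sphere n"
    and "\<And>x. x \<in> coord_sphere n \<Longrightarrow> f (- x) = - f x"
  shows "odd (sphere_degree n f)"
  using assms
proof (induction n arbitrary: f)
  case 0
  then show ?case by (intro odd_sphere_degree_0)
next
  case (Suc n)
  let ?S = "coord_sphere (Suc n) :: 'b set" and ?T = "coord_subspace (Suc n) :: 'b set"
  let ?b = "bvec (Suc n) :: 'b"
  have sT: "subspace ?T" by (rule subspace_coord_subspace)
  have SS: "coord_sphere n \<subseteq> ?S" by (rule coord_sphere_mono) simp
  have bS: "?b \<in> ?S" using Suc.prems(1) by (rule bvec_coord_sphere)
  then have bb: "?b \<bullet> ?b = 1" by (simp add: coord_sphere_def norm_eq_1)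
  obtain p v where p: "continuous_on ?S p" "p \<in> ?S \<rightarrow> ?S" "\<And>x. x \<in> ?S \<Longrightarrow> p (- x) = - p x"
      "sphere_degree (Suc n) p = sphere_degree (Suc n) f"
    and v: "v \<in> ?S" "v \<notin> p ` coord_sphere n" "- v \<notin> p ` coord_sphere n"
    using odd_map_homotopic_missing_axis[OF Suc.prems] by metis
  define A where "A = hyperplane_reflection (v - ?b)"
  have AS: "A \<in> ?S \<rightarrow> ?S"
  proof
    fix x assume "x \<in> ?S"
    then have "A x \<in> ?T"
      unfolding A_def hyperplane_reflection_def using v(1) bS
      by (intro subspace_diff subspace_scale sT) (auto simp: coord_sphere_def)
    then show "A x \<in> ?S"
      using \<open>x \<in> ?S\<close> by (simp add: coord_sphere_def A_def)
  qed
  have Acont: "continuous_on X A" for X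
    unfolding A_def hyperplane_reflection_def
    by (cases "v = ?b") (auto intro!: continuous_intros)
  have Av: "A v = ?b"
    unfolding A_def using v(1) bS by (intro hyperplane_reflection_maps) (simp add: coord_sphere_def)
  define q where "q = A \<circ> p"
  have q: "continuous_on ?S q" "q \<in> ?S \<rightarrow> ?S"
    unfolding q_def using AS p(2) by (intro continuous_on_compose p(1) Acont, auto)
  have qm: "q (- x) = - q x" if "x \<in> ?S" for x
    using p(3)[OF that] by (simp add: q_def A_def hyperplane_reflection_minus)
  have qaxis: "q x \<noteq> ?b \<and> q x \<noteq> - ?b" if "x \<in> coord_sphere n" for x
  proof -
    have AA: "A (A y) = y" for y
      by (simp add: A_def hyperplane_reflection_involution)
    have "p x \<noteq> v" "p x \<noteq> - v" using v that by (metis image_eqI)+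
    moreover have "A ?b = v" "A (- ?b) = - v"
      using AA[of v] Av by (auto simp: A_def hyperplane_reflection_minus)
    ultimately show ?thesis
      unfolding q_def using AA[of "p x"] by (metis comp_apply)
  qed
  \<comment> \<open>At \<open>t = 1\<close> the last coordinate is removed completely on the equator and not at all at the
    poles. Off the equator the factor that is removed is below 1, so a zero would need \<open>q x\<close> to lie on
    the axis with \<open>x\<close> on the equator.\<close>
  define H where "H t x = q x - (t * (1 - \<bar>x \<bullet> ?b\<bar>) * (q x \<bullet> ?b)) *\<^sub>R ?b" for t x
  have H0: "H t x \<in> ?T \<and> H t x \<noteq> 0" if t: "t \<in> {0..1}" and x: "x \<in> ?S" for t x
  proof
    have qx: "q x \<in> ?S" using q(2) x by auto
    then show "H t x \<in> ?T"
      unfolding H_def using bS by (intro subspace_diff subspace_scale sT) (auto simp: coord_sphere_def)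
    show "H t x \<noteq> 0"
    proof
      assume "H t x = 0"
      define c where "c = q x \<bullet> ?b"
      define s where "s = t * (1 - \<bar>x \<bullet> ?b\<bar>)"
      have eq: "q x = (s * c) *\<^sub>R ?b"
        using \<open>H t x = 0\<close> by (simp add: H_def s_def c_def)
      have "c = s * c"
        unfolding c_def by (subst eq) (simp add: bb c_def)
      moreover have "c \<noteq> 0" using eq qx by (auto simp: coord_sphere_def)
      ultimately have "s = 1" by simp
      have "norm ?b = 1" using bb by (simp add: norm_eq_1)
      moreover have "norm (q x) = 1" using qx by (simp add: coord_sphere_def)
      ultimately have "\<bar>c\<bar> = 1" using eq \<open>s = 1\<close> by simp
      have "x \<bullet> ?b = 0"
      proof (rule ccontr)
        assume "x \<bullet> ?b \<noteq> 0"
        moreover have "\<bar>x \<bullet> ?b\<bar> \<le> 1"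
          using Cauchy_Schwarz_ineq2[of x ?b] x \<open>norm ?b = 1\<close> by (simp add: coord_sphere_def)
        ultimately have "s < 1"
          unfolding s_def using t by (intro le_less_trans[OF mult_left_le_one_le]) auto
        with \<open>s = 1\<close> show False by simp
      qed
      then have "x \<in> coord_sphere n"
        using x coord_subspace_Suc[OF Suc.prems(1)] by (auto simp: coord_sphere_def)
      moreover have "q x = ?b \<or> q x = - ?b"
        using eq \<open>s = 1\<close> \<open>\<bar>c\<bar> = 1\<close> by (auto simp: abs_if split: if_splits)
      ultimately show False using qaxis by blast
    qed
  qed
  define r where "r x = sgn (H 1 x)" for x
  have contH: "continuous_on ({0..1} \<times> ?S) (\<lambda>(t, x). H t x)"
    unfolding H_def case_prod_unfold
    by (intro continuous_intros continuous_on_compose2[OF q(1)]) auto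
  have "sphere_degree (Suc n) (\<lambda>x. sgn (H 0 x)) = sphere_degree (Suc n) r"
    unfolding r_def using Suc.prems(1) contH H0 by (intro sphere_degree_homotopy) auto
  moreover have "sphere_degree (Suc n) (\<lambda>x. sgn (H 0 x)) = sphere_degree (Suc n) q"
    using Suc.prems(1) q(2) by (intro sphere_degree_cong) (auto simp: H_def Pi_iff)
  moreover have "even (sphere_degree (Suc n) r - sphere_degree n r)" "odd (sphere_degree n r)"
  proof -
    have "continuous_on ?S (H 1)"
      unfolding H_def by (intro continuous_intros q(1))
    then have rc: "continuous_on ?S r"
      unfolding r_def using H0[of 1] by (intro continuous_on_sgn) auto
    have rS: "r \<in> ?S \<rightarrow> ?S"
      unfolding r_def using H0[of 1] by (auto intro: sgn_in_coord_sphere)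
    have rm: "r (- x) = - r x" if "x \<in> ?S" for x
      unfolding r_def H_def using qm[OF that]
      by (simp add: sgn_div_norm norm_minus_commute algebra_simps flip: scaleR_minus_right)
    have rS': "r \<in> coord_sphere n \<rightarrow> coord_sphere n"
    proof
      fix x :: 'b assume x: "x \<in> coord_sphere n"
      then have "x \<bullet> ?b = 0" "x \<in> ?S"
        using coord_subspace_Suc[OF Suc.prems(1)] SS by (auto simp: coord_sphere_def)
      then have "H 1 x \<bullet> ?b = 0" "H 1 x \<in> ?T" "H 1 x \<noteq> 0"
        using H0[of 1 x] by (auto simp: H_def inner_diff_left bb)
      then show "r x \<in> coord_sphere n"
        unfolding r_def using coord_subspace_Suc[OF Suc.prems(1)]
        by (intro sgn_in_coord_sphere) auto
    qed
    show "even (sphere_degree (Suc n) r - sphere_degree n r)"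
      using Suc.prems(1) rc rS rm rS' by (intro sphere_degree_odd_step)
    show "odd (sphere_degree n r)"
      using Suc.prems(1) rc rm rS' SS
      by (intro Suc.IH) (auto intro: continuous_on_subset)
  qed
  moreover have "sphere_degree (Suc n) q = sphere_degree (Suc n) A * sphere_degree (Suc n) f"
    unfolding q_def using Suc.prems(1) p AS
    by (subst sphere_degree_compose) (auto intro: Acont)
  ultimately have "odd (sphere_degree (Suc n) A * sphere_degree (Suc n) f)"
    by simp
  then show ?case by (simp only: even_mult_iff) blast
qed

text \<open>If there were no common zero, normalizing the vector of the \<open>N\<close> values would give an odd
  self-map of the sphere with zero last coordinate. It is not surjective, so its degree is 0, which is
  even.\<close>

theorem Borsuk_Ulam_common_zero:
  fixes g :: "nat \<Rightarrow> 'b::euclidean_space \<Rightarrow> real"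
  assumes N: "N < DIM('b)"
    and cont: "\<And>i. i < N \<Longrightarrow> continuous_on (sphere 0 1) (g i)"
    and odd: "\<And>i x. i < N \<Longrightarrow> norm x = 1 \<Longrightarrow> g i (- x) = - g i x"
  obtains x where "norm x = 1" "\<And>i. i < N \<Longrightarrow> g i x = 0"
proof (rule ccontr)
  note witness = that
  assume no: "\<not> thesis"
  obtain n where n: "DIM('b) = Suc n"
    using DIM_positive[where 'a='b] gr0_implies_Suc by blast
  have top: "coord_sphere n = (sphere 0 1 :: 'b set)"
    using n by (auto simp: coord_sphere_def coord_subspace_def)
  define h where "h x = (\<Sum>i<N. g i x *\<^sub>R (bvec i :: 'b))" for x
  have hb: "h x \<bullet> bvec i = (if i < N then g i x else 0)" if "i < DIM('b)" for i x
  proof -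
    have "h x \<bullet> bvec i = (\<Sum>k<N. if k = i then g i x else 0)"
      unfolding h_def inner_sum_left using that N
      by (intro sum.cong) (auto simp: inner_bvec)
    then show ?thesis by simp
  qed
  have h0: "h x \<noteq> 0" if "norm x = 1" for x
  proof
    assume "h x = 0"
    then have "g i x = 0" if "i < N" for i
      using hb[of i x] that N by simp
    then show False using no witness[OF \<open>norm x = 1\<close>] by blast
  qed
  define f where "f x = sgn (h x)" for x
  have "continuous_on (coord_sphere n) f"
    unfolding f_def h_def top using cont h0
    by (intro continuous_on_sgn continuous_intros) (auto simp: h_def)
  moreover have "f \<in> coord_sphere n \<rightarrow> coord_sphere n"
    unfolding f_def top using h0 by (auto simp: norm_sgn)
  moreover have "f (- x) = - f x" if "x \<in> coord_sphere n" for x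
  proof -
    have "h (- x) = - h x"
      unfolding h_def using odd that by (auto simp: top simp flip: sum_negf)
    then show ?thesis by (simp add: f_def sgn_minus)
  qed
  moreover have "n < DIM('b)" using n by simp
  moreover have "bvec n \<notin> f ` coord_sphere n"
  proof
    assume "bvec n \<in> f ` coord_sphere n"
    then obtain x where "bvec n = sgn (h x)" by (auto simp: f_def)
    moreover have "sgn (h x) \<bullet> bvec n = 0"
      using hb[of n x] n N by (simp add: sgn_div_norm)
    ultimately show False
      using inner_bvec[of n n, where 'b='b] n by simp
  qed
  ultimately show False
    using odd_sphere_degree[of n f] sphere_degree_nonsurjective[of n f "bvec n"] bvec_coord_sphere
    by (metis even_zero)
qed

section \<open>Common medians in a family of odd quotients\<close>

text \<open>The functions \<open>squash (k * s)\<close> are bounded, continuous and odd in \<open>s\<close>, and tend to the sign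
  of \<open>s\<close> as \<open>k\<close> grows. For a distribution without atoms, a median is a point where the
  expected sign of the deviation vanishes, so they yield approximate medians that depend continuously on the data.\<close>

definition squash :: "real \<Rightarrow> real"
  where "squash s = s / (1 + \<bar>s\<bar>)"

lemma abs_squash_le_1: "\<bar>squash s\<bar> \<le> 1"
  by (simp add: squash_def abs_divide divide_le_eq)

lemma squash_minus: "squash (- s) = - squash s"
  by (simp add: squash_def)

lemma continuous_on_squash [continuous_intros]:
  "continuous_on S f \<Longrightarrow> continuous_on S (\<lambda>x. squash (f x))"
  unfolding squash_def by (intro continuous_intros) (auto simp: add_nonneg_eq_0_iff)

lemma borel_measurable_squash [measurable]: "squash \<in> borel_measurable borel"
  by (intro borel_measurable_continuous_onI continuous_on_squash continuous_on_id)

lemma tendsto_squash: "(f \<longlongrightarrow> l) F \<Longrightarrow> ((\<lambda>x. squash (f x)) \<longlongrightarrow> squash l) F"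
  unfolding squash_def by (intro tendsto_intros) (auto simp: add_nonneg_eq_0_iff)

lemma squash_at_top: "filterlim f at_top F \<Longrightarrow> ((\<lambda>x. squash (f x)) \<longlongrightarrow> 1) F"
proof -
  have "(squash \<longlongrightarrow> 1) at_top"
    unfolding squash_def by real_asymp
  then show "filterlim f at_top F \<Longrightarrow> ((\<lambda>x. squash (f x)) \<longlongrightarrow> 1) F"
    by (rule filterlim_compose)
qed

text \<open>The passage from approximate to exact medians. The functions \<open>s n\<close> converge to \<open>- 1\<close> on \<open>E\<close> but
  are uncontrolled elsewhere, apart from being at most 1. In the limit their expectation is
  therefore at most the probability of the complement of \<open>E\<close> minus the probability of \<open>E\<close>; as it is not
  negative in the limit, the complement has at least half of the mass.\<close>

lemma (in prob_space) half_le_prob_Compl_of_tendsto: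
  fixes s :: "nat \<Rightarrow> 'a \<Rightarrow> real"
  assumes s: "\<And>n. s n \<in> borel_measurable M" "\<And>n x. x \<in> space M \<Longrightarrow> \<bar>s n x\<bar> \<le> 1"
    and E: "E \<in> events" "\<And>x. x \<in> E \<Longrightarrow> (\<lambda>n. s n x) \<longlonglongrightarrow> - 1"
    and c: "\<And>n. c n \<le> expectation (s n)" "c \<longlonglongrightarrow> 0"
  shows "prob (space M - E) \<ge> 1 / 2"
proof -
  note [measurable] = s(1) E(1)
  have lim: "(\<lambda>n. expectation (\<lambda>x. indicator E x * s n x)) \<longlonglongrightarrow> expectation (\<lambda>x. - indicator E x)"
  proof (rule integral_dominated_convergence[where w = "\<lambda>_. 1"])
    show "AE x in M. (\<lambda>n. indicator E x * s n x) \<longlonglongrightarrow> - indicator E x"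
      using E(2) by (intro AE_I2) (auto simp: indicator_def)
    show "AE x in M. norm (indicator E x * s n x) \<le> 1" for n
      using s(2) by (intro AE_I2) (auto simp: indicator_def)
  qed auto
  have "c n - prob (space M - E) \<le> expectation (\<lambda>x. indicator E x * s n x)" for n
  proof -
    have int: "integrable M (s n)" "integrable M (\<lambda>x. indicator E x * s n x)"
      using s(2) by (auto intro!: integrable_const_bound[where B = 1] AE_I2 simp: indicator_def)
    have int_ind: "integrable M (indicator (space M - E) :: 'a \<Rightarrow> real)"
      by (intro integrable_const_bound[where B = 1]) auto
    have "expectation (s n) \<le> expectation (\<lambda>x. indicator E x * s n x + indicator (space M - E) x)"
    proof (intro integral_mono Bochner_Integration.integrable_add int int_ind)
      show "s n x \<le> indicator E x * s n x + indicator (space M - E) x" if "x \<in> space M" for x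
        using s(2)[OF that, of n] that by (auto simp: indicator_def)
    qed
    also have "\<dots> = expectation (\<lambda>x. indicator E x * s n x) + prob (space M - E)"
      using int int_ind by (subst Bochner_Integration.integral_add) auto
    finally show ?thesis using c(1)[of n] by linarith
  qed
  then have "0 - prob (space M - E) \<le> expectation (\<lambda>x. - indicator E x)"
    by (intro LIMSEQ_le[OF _ lim, of "\<lambda>n. c n - prob (space M - E)"] tendsto_intros c(2)) auto
  also have "\<dots> = - prob E" by simp
  finally show ?thesis
    using prob_compl[OF E(1)] by linarith
qed

text \<open>The quotient \<open>A e h / B e h\<close> is the position at which the random hyperplane \<open>h\<close> meets the line
  spanned by \<open>e\<close>; it is \<open>0 / 0\<close> if they are parallel, and such a hyperplane counts on both sides.
  Reversing \<open>e\<close> reverses the sign of the position. Only these symmetries and continuity enter the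
  argument, so the hyperplanes are kept abstract.\<close>

locale odd_quotient_family =
  fixes M :: "nat \<Rightarrow> 'h measure" and N :: nat
    and A B :: "'w::euclidean_space \<Rightarrow> 'h \<Rightarrow> real"
  assumes prob: "j < N \<Longrightarrow> prob_space (M j)"
    and N: "0 < N" "N \<le> DIM('w)"
    and A_meas: "j < N \<Longrightarrow> A e \<in> borel_measurable (M j)"
    and B_meas: "j < N \<Longrightarrow> B e \<in> borel_measurable (M j)"
    and A_cont: "j < N \<Longrightarrow> h \<in> space (M j) \<Longrightarrow> continuous_on UNIV (\<lambda>e. A e h)"
    and B_cont: "j < N \<Longrightarrow> h \<in> space (M j) \<Longrightarrow> continuous_on UNIV (\<lambda>e. B e h)"
    and A_odd: "A (- e) h = - A e h"
    and B_even: "B (- e) h = B e h"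
    and B_nonneg: "B e h \<ge> 0"
    and B_zero: "B e h = 0 \<Longrightarrow> A e h = 0"
begin

definition imbalance :: "nat \<Rightarrow> nat \<Rightarrow> 'w \<Rightarrow> real \<Rightarrow> real"
  where "imbalance j k e x = (\<integral>h. squash (real (Suc k) * (A e h - x * B e h)) \<partial>M j)"

lemma imbalance_integrand_measurable:
  "j < N \<Longrightarrow> (\<lambda>h. squash (c * (A e h - x * B e h))) \<in> borel_measurable (M j)"
  using A_meas[of j e] B_meas[of j e] by measurable

lemma tendsto_A: "u \<longlonglongrightarrow> e \<Longrightarrow> j < N \<Longrightarrow> h \<in> space (M j) \<Longrightarrow> (\<lambda>n. A (u n) h) \<longlonglongrightarrow> A e h"
  by (rule continuous_on_tendsto_compose[OF A_cont]) auto

lemma tendsto_B: "u \<longlonglongrightarrow> e \<Longrightarrow> j < N \<Longrightarrow> h \<in> space (M j) \<Longrightarrow> (\<lambda>n. B (u n) h) \<longlonglongrightarrow> B e h"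
  by (rule continuous_on_tendsto_compose[OF B_cont]) auto

lemma abs_imbalance_le_1: "j < N \<Longrightarrow> \<bar>imbalance j k e x\<bar> \<le> 1"
proof -
  assume j: "j < N"
  then interpret prob_space "M j" by (rule prob)
  have "norm (imbalance j k e x) \<le> (\<integral>h. norm (squash (real (Suc k) * (A e h - x * B e h))) \<partial>M j)"
    unfolding imbalance_def by (rule integral_norm_bound)
  also have "\<dots> \<le> (\<integral>h. 1 \<partial>M j)"
    using imbalance_integrand_measurable[OF j]
    by (intro integral_mono integrable_norm integrable_const_bound[where B = 1] AE_I2)
      (auto simp: abs_squash_le_1)
  finally show ?thesis by (simp add: prob_space)
qed

lemma imbalance_odd: "imbalance j k (- e) (- x) = - imbalance j k e x"
proof -
  have "imbalance j k (- e) (- x) = (\<integral>h. - squash (real (Suc k) * (A e h - x * B e h)) \<partial>M j)"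
    unfolding imbalance_def
    by (intro Bochner_Integration.integral_cong refl)
      (simp add: A_odd B_even algebra_simps flip: squash_minus)
  then show ?thesis by (simp add: imbalance_def)
qed

lemma tendsto_imbalance:
  assumes "j < N" "u \<longlonglongrightarrow> e" "y \<longlonglongrightarrow> x"
  shows "(\<lambda>n. imbalance j k (u n) (y n)) \<longlonglongrightarrow> imbalance j k e x"
proof -
  interpret prob_space "M j" using assms(1) by (rule prob)
  show ?thesis
    unfolding imbalance_def
  proof (rule integral_dominated_convergence[where w = "\<lambda>_. 1"])
    show "AE h in M j. (\<lambda>n. squash (real (Suc k) * (A (u n) h - y n * B (u n) h)))
        \<longlonglongrightarrow> squash (real (Suc k) * (A e h - x * B e h))"
      using assms by (intro AE_I2 tendsto_squash tendsto_intros tendsto_A tendsto_B)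
  qed (auto simp: abs_squash_le_1 imbalance_integrand_measurable assms(1))
qed

text \<open>The pairs of a direction and a position form a noncompact space. It is compactified by writing
  a pair as \<open>(e / norm e, z / norm e)\<close> with \<open>(e, z)\<close> on the unit sphere of a space of one more
  dimension and adding the poles \<open>e = 0\<close>. Borsuk-Ulam is applied to the odd functions
  \<open>norm e * imbalance j k (e / norm e) (z / norm e) - z / (k + 1)\<close> on this sphere. As the imbalance is
  bounded, the first factor makes them continuous at the poles, and the last term makes them nonzero
  there, so that a common zero is not a pole. The price is the error \<open>x / (k + 1)\<close>; by symmetry \<open>x\<close>
  may be taken to be nonnegative, which fixes the sign of the error.\<close>

lemma exists_balanced_line:
  obtains e x where "norm e = 1" "x \<ge> 0" "\<And>j. j < N \<Longrightarrow> imbalance j k e x = x / real (Suc k)"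
proof -
  define g where "g j p = norm (fst p) * imbalance j k (sgn (fst p)) (snd p / norm (fst p))
      - snd p / real (Suc k)" for j and p :: "'w \<times> real"
  have "continuous_on UNIV (g j)" if j: "j < N" for j
    unfolding continuous_on_sequentially
  proof (intro ballI allI impI)
    fix p :: "'w \<times> real" and q assume "(\<forall>n. q n \<in> UNIV) \<and> q \<longlonglongrightarrow> p"
    then have fs: "(\<lambda>n. fst (q n)) \<longlonglongrightarrow> fst p" "(\<lambda>n. snd (q n)) \<longlonglongrightarrow> snd p"
      by (auto intro: tendsto_fst tendsto_snd)
    have "(\<lambda>n. norm (fst (q n)) * imbalance j k (sgn (fst (q n))) (snd (q n) / norm (fst (q n))))
        \<longlonglongrightarrow> norm (fst p) * imbalance j k (sgn (fst p)) (snd p / norm (fst p))"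
    proof (cases "fst p = 0")
      case False
      then show ?thesis
        by (intro tendsto_mult tendsto_norm tendsto_imbalance[OF j] tendsto_sgn tendsto_divide fs) auto
    next
      case True
      have "(\<lambda>n. norm (fst (q n)) * imbalance j k (sgn (fst (q n))) (snd (q n) / norm (fst (q n)))) \<longlonglongrightarrow> 0"
      proof (rule Lim_null_comparison)
        show "\<forall>\<^sub>F n in sequentially. norm (norm (fst (q n)) *
            imbalance j k (sgn (fst (q n))) (snd (q n) / norm (fst (q n)))) \<le> norm (fst (q n))"
          using abs_imbalance_le_1[OF j] by (intro always_eventually) (simp add: abs_mult mult_left_le)
        show "(\<lambda>n. norm (fst (q n))) \<longlonglongrightarrow> 0"
          using tendsto_norm[OF fs(1)] True by simp
      qed
      then show ?thesis using True by simp
    qed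
    then show "(g j \<circ> q) \<longlonglongrightarrow> g j p"
      unfolding g_def o_def using fs by (intro tendsto_diff tendsto_divide) auto
  qed
  then have "continuous_on (sphere 0 1) (g j)" if "j < N" for j
    using that continuous_on_subset by blast
  moreover have "g j (- p) = - g j p" for j p
    unfolding g_def by (simp add: sgn_minus imbalance_odd)
  moreover have "N < DIM('w \<times> real)" using N by simp
  ultimately obtain p where p: "norm p = 1" "\<And>j. j < N \<Longrightarrow> g j p = 0"
    using Borsuk_Ulam_common_zero[of N g] by metis
  define e z where "e = fst p" and "z = snd p"
  have bal: "norm e * imbalance j k (sgn e) (z / norm e) = z / real (Suc k)" if "j < N" for j
    using p(2)[OF that] by (simp add: g_def e_def z_def)
  have "e \<noteq> 0"
  proof
    assume "e = 0"
    then have "z = 0" using bal[OF N(1)] by simp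
    then show False using p(1) \<open>e = 0\<close> by (simp add: e_def z_def norm_prod_def)
  qed
  define x where "x = z / norm e"
  have bal': "imbalance j k (sgn e) x = x / real (Suc k)" if "j < N" for j
    using bal[OF that] \<open>e \<noteq> 0\<close> by (simp add: x_def field_simps del: of_nat_Suc)
  show thesis
  proof (cases "x \<ge> 0")
    case True
    then show ?thesis using \<open>e \<noteq> 0\<close> bal' by (intro that[of "sgn e" x]) (auto simp: norm_sgn)
  next
    case False
    then show ?thesis using \<open>e \<noteq> 0\<close> bal'
      by (intro that[of "- sgn e" "- x"]) (auto simp: norm_sgn imbalance_odd)
  qed
qed

text \<open>Let \<open>k\<close> tend to infinity along the approximate solutions \<open>(u k, x k)\<close>. If the positions \<open>x k\<close> have a
  bounded subsequence, a limit point is a common median: the error \<open>x k / (k + 1)\<close> tends to 0 there.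
  If they tend to infinity, the error is not controlled, but it is nonnegative; since every hyperplane
  with \<open>B e h > 0\<close> eventually contributes about \<open>- 1\<close>, those with \<open>B e h = 0\<close> carry at least half of each
  measure. They count on both sides, so every position is a median, and 0 is taken.\<close>

theorem exists_common_median:
  obtains e x where "e \<noteq> 0"
    "\<And>j. j < N \<Longrightarrow> measure (M j) {h \<in> space (M j). A e h \<ge> x * B e h} \<ge> 1 / 2"
    "\<And>j. j < N \<Longrightarrow> measure (M j) {h \<in> space (M j). A e h \<le> x * B e h} \<ge> 1 / 2"
proof -
  have "\<forall>k. \<exists>e x. norm e = 1 \<and> x \<ge> 0 \<and> (\<forall>j<N. imbalance j k e x = x / real (Suc k))"
    using exists_balanced_line by metis
  then obtain u x where u: "\<And>k. norm (u k) = 1" and x: "\<And>k. x k \<ge> 0"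
    and bal: "\<And>k j. j < N \<Longrightarrow> imbalance j k (u k) (x k) = x k / real (Suc k)"
    by metis
  define s where "s k h = squash (real (Suc k) * (A (u k) h - x k * B (u k) h))" for k h
  have s_meas: "s k \<in> borel_measurable (M j)" if "j < N" for j k
    unfolding s_def[abs_def] using that by (rule imbalance_integrand_measurable)
  have s_int: "(\<integral>h. s k h \<partial>M j) = x k / real (Suc k)" if "j < N" for j k
    using bal[OF that] by (simp add: s_def imbalance_def del: of_nat_Suc)
  have Suc_top: "filterlim (\<lambda>n. real (Suc (r n))) at_top sequentially" if "strict_mono r" for r :: "nat \<Rightarrow> nat"
    using filterlim_subseq[OF that]
    by (intro filterlim_compose[OF filterlim_real_sequentially] filterlim_compose[OF filterlim_Suc])
  show thesis
  proof (cases "filterlim x at_top sequentially")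
    case True
    have "\<forall>k. u k \<in> sphere 0 1" using u by simp
    then obtain e r where "e \<in> sphere 0 1" and r: "strict_mono r" "(u \<circ> r) \<longlonglongrightarrow> e"
      by (rule seq_compactE[OF compact_imp_seq_compact[OF compact_sphere]])
    then have e: "norm e = 1" by simp
    have half: "measure (M j) {h \<in> space (M j). B e h = 0} \<ge> 1 / 2" if j: "j < N" for j
    proof -
      interpret prob_space "M j" using j by (rule prob)
      note [measurable] = B_meas[OF j, of e]
      have "1 / 2 \<le> prob (space (M j) - {h \<in> space (M j). B e h \<noteq> 0})"
      proof (rule half_le_prob_Compl_of_tendsto[of "\<lambda>n. s (r n)" _ "\<lambda>_. 0"])
        show "(\<lambda>n. s (r n) h) \<longlonglongrightarrow> - 1" if "h \<in> {h \<in> space (M j). B e h \<noteq> 0}" for h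
        proof -
          have h: "h \<in> space (M j)" "B e h > 0" using that B_nonneg[of e h] by auto
          have "(\<lambda>n. A (u (r n)) h) \<longlonglongrightarrow> A e h" "(\<lambda>n. B (u (r n)) h) \<longlonglongrightarrow> B e h"
            by (rule tendsto_A[OF r(2)[unfolded o_def] j h(1)], rule tendsto_B[OF r(2)[unfolded o_def] j h(1)])
          moreover have "filterlim (\<lambda>n. x (r n)) at_top sequentially"
            using filterlim_compose[OF True filterlim_subseq[OF r(1)]] .
          ultimately have "filterlim (\<lambda>n. - A (u (r n)) h + B (u (r n)) h * x (r n)) at_top sequentially"
            by (intro filterlim_tendsto_add_at_top[OF tendsto_minus]
                filterlim_tendsto_pos_mult_at_top[OF _ h(2)])
          then have "(\<lambda>n. squash (real (Suc (r n)) * (- A (u (r n)) h + B (u (r n)) h * x (r n)))) \<longlonglongrightarrow> 1"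
            by (intro squash_at_top filterlim_at_top_mult_at_top Suc_top r(1))
          then have "(\<lambda>n. - squash (real (Suc (r n)) * (- A (u (r n)) h + B (u (r n)) h * x (r n)))) \<longlonglongrightarrow> - 1"
            by (rule tendsto_minus)
          then show ?thesis
            unfolding s_def squash_minus[symmetric] by (simp add: algebra_simps del: of_nat_Suc)
        qed
      qed (auto simp: s_int s_meas j x, auto simp: s_def abs_squash_le_1)
      also have "space (M j) - {h \<in> space (M j). B e h \<noteq> 0} = {h \<in> space (M j). B e h = 0}"
        by auto
      finally show ?thesis .
    qed
    show thesis
    proof (rule that)
      show "e \<noteq> 0" using e by auto
      fix j assume j: "j < N"
      interpret prob_space "M j" using j by (rule prob)
      note [measurable] = A_meas[OF j, of e]
      have sub: "{h \<in> space (M j). B e h = 0} \<subseteq> {h \<in> space (M j). A e h \<ge> 0 * B e h}"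
        "{h \<in> space (M j). B e h = 0} \<subseteq> {h \<in> space (M j). A e h \<le> 0 * B e h}"
        by (auto simp: B_zero)
      show "1 / 2 \<le> prob {h \<in> space (M j). A e h \<ge> 0 * B e h}"
        by (rule order_trans[OF half[OF j] finite_measure_mono[OF sub(1)]]) simp
      show "1 / 2 \<le> prob {h \<in> space (M j). A e h \<le> 0 * B e h}"
        by (rule order_trans[OF half[OF j] finite_measure_mono[OF sub(2)]]) simp
    qed
  next
    case False
    then obtain c where "\<not> eventually (\<lambda>n. c \<le> x n) sequentially"
      unfolding filterlim_at_top by blast
    then obtain r :: "nat \<Rightarrow> nat" where r: "strict_mono r" "\<And>n. \<not> c \<le> x (r n)"
      using not_eventually_sequentiallyD by blast
    have comp: "seq_compact (sphere (0 :: 'w) 1 \<times> {0..c})"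
      by (intro compact_imp_seq_compact compact_Times) auto
    have "\<forall>n. (u (r n), x (r n)) \<in> sphere 0 1 \<times> {0..c}"
      using u x r(2) by (auto simp: not_le intro: less_imp_le)
    then obtain p r' where p: "p \<in> sphere 0 1 \<times> {0..c}" and r': "strict_mono r'"
      "((\<lambda>n. (u (r n), x (r n))) \<circ> r') \<longlonglongrightarrow> p"
      by (rule seq_compactE[OF comp])
    define e y q where "e = fst p" and "y = snd p" and "q = r \<circ> r'"
    have q: "strict_mono q" using r(1) r'(1) by (simp add: q_def strict_mono_o)
    have lim: "(\<lambda>n. u (q n)) \<longlonglongrightarrow> e" "(\<lambda>n. x (q n)) \<longlonglongrightarrow> y"
      using tendsto_fst[OF r'(2)] tendsto_snd[OF r'(2)] by (auto simp: e_def y_def q_def o_def)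
    have c0: "(\<lambda>n. x (q n) / real (Suc (q n))) \<longlonglongrightarrow> 0"
      by (rule tendsto_divide_0[OF lim(2)]) (rule filterlim_at_top_imp_at_infinity[OF Suc_top[OF q]])
    have pos: "(\<lambda>n. s (q n) h) \<longlonglongrightarrow> 1" if "j < N" "h \<in> space (M j)" "A e h > y * B e h" for j h
    proof -
      have "(\<lambda>n. A (u (q n)) h - x (q n) * B (u (q n)) h) \<longlonglongrightarrow> A e h - y * B e h"
        using that(1,2) lim by (intro tendsto_intros tendsto_A tendsto_B)
      then have "filterlim (\<lambda>n. (A (u (q n)) h - x (q n) * B (u (q n)) h) * real (Suc (q n))) at_top sequentially"
        using that(3) by (intro filterlim_tendsto_pos_mult_at_top[OF _ _ Suc_top[OF q]]) auto
      then show ?thesis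
        unfolding s_def by (subst mult.commute) (rule squash_at_top)
    qed
    have neg: "(\<lambda>n. - s (q n) h) \<longlonglongrightarrow> 1" if "j < N" "h \<in> space (M j)" "A e h < y * B e h" for j h
    proof -
      have "(\<lambda>n. x (q n) * B (u (q n)) h - A (u (q n)) h) \<longlonglongrightarrow> y * B e h - A e h"
        using that(1,2) lim by (intro tendsto_intros tendsto_A tendsto_B)
      then have "filterlim (\<lambda>n. (x (q n) * B (u (q n)) h - A (u (q n)) h) * real (Suc (q n))) at_top sequentially"
        using that(3) by (intro filterlim_tendsto_pos_mult_at_top[OF _ _ Suc_top[OF q]]) auto
      then have "(\<lambda>n. squash ((x (q n) * B (u (q n)) h - A (u (q n)) h) * real (Suc (q n)))) \<longlonglongrightarrow> 1"
        by (rule squash_at_top)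
      then show ?thesis
        unfolding s_def squash_minus[symmetric] by (simp add: algebra_simps del: of_nat_Suc)
    qed
    show thesis
    proof (rule that)
      show "e \<noteq> 0" using p by (auto simp: e_def)
      fix j assume j: "j < N"
      interpret prob_space "M j" using j by (rule prob)
      note [measurable] = A_meas[OF j, of e] B_meas[OF j, of e]
      have "1 / 2 \<le> prob (space (M j) - {h \<in> space (M j). A e h < y * B e h})"
      proof (rule half_le_prob_Compl_of_tendsto[of "\<lambda>n. s (q n)" _ "\<lambda>n. x (q n) / real (Suc (q n))"])
        show "(\<lambda>n. s (q n) h) \<longlonglongrightarrow> - 1" if "h \<in> {h \<in> space (M j). A e h < y * B e h}" for h
          using tendsto_minus[OF neg[OF j, of h]] that by simp
      qed (auto simp: s_int s_meas j c0 simp del: of_nat_Suc, auto simp: s_def abs_squash_le_1)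
      also have "space (M j) - {h \<in> space (M j). A e h < y * B e h} = {h \<in> space (M j). A e h \<ge> y * B e h}"
        by auto
      finally show "1 / 2 \<le> prob {h \<in> space (M j). A e h \<ge> y * B e h}" .
      have "1 / 2 \<le> prob (space (M j) - {h \<in> space (M j). A e h > y * B e h})"
      proof (rule half_le_prob_Compl_of_tendsto[of "\<lambda>n h. - s (q n) h" _ "\<lambda>n. - (x (q n) / real (Suc (q n)))"])
        show "(\<lambda>n. - s (q n) h) \<longlonglongrightarrow> - 1" if "h \<in> {h \<in> space (M j). A e h > y * B e h}" for h
          using tendsto_minus[OF pos[OF j, of h]] that by simp
        show "(\<lambda>n. - (x (q n) / real (Suc (q n)))) \<longlonglongrightarrow> 0"
          using tendsto_minus[OF c0] by simp
      qed (auto simp: s_int s_meas j simp del: of_nat_Suc, auto simp: s_def abs_squash_le_1)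
      also have "space (M j) - {h \<in> space (M j). A e h > y * B e h} = {h \<in> space (M j). A e h \<le> y * B e h}"
        by auto
      finally show "1 / 2 \<le> prob {h \<in> space (M j). A e h \<le> y * B e h}" .
    qed
  qed
qed

end

section \<open>A Euclidean model of a finite-dimensional space\<close>

definition finite_basis :: "'a::real_vector set \<Rightarrow> bool"
  where "finite_basis B \<longleftrightarrow> finite B \<and> B \<noteq> {} \<and> independent B \<and> span B = UNIV"

text \<open>The vector space is only known to be normed with a basis of \<open>m + 1\<close> elements, whereas the
  topological results are about Euclidean spaces, whose dimension is fixed by their type. A chosen
  finite basis, made into a type, provides the index type of a Euclidean space of the right
  dimension. The value \<open>{0}\<close> keeps the set nonempty and finite for the spaces that have no finite
  nonempty basis, so that the type is finite for every argument.\<close>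

definition index_vectors :: "'a::real_vector set"
  where "index_vectors = (if \<exists>B :: 'a set. finite_basis B then SOME B. finite_basis B else {0})"

lemma finite_basis_index_vectors:
  "finite_basis (B :: 'a set) \<Longrightarrow> finite_basis (index_vectors :: 'a::real_vector set)"
  unfolding index_vectors_def by (auto intro: someI)

lemma finite_index_vectors: "finite (index_vectors :: 'a::real_vector set)"
  and index_vectors_nonempty: "index_vectors \<noteq> ({} :: 'a set)"
proof -
  have "finite (index_vectors :: 'a set) \<and> index_vectors \<noteq> ({} :: 'a set)"
  proof (cases "\<exists>B :: 'a set. finite_basis B")
    case True
    then show ?thesis
      using finite_basis_index_vectors[where 'a = 'a] unfolding finite_basis_def by blast
  next
    case False
    then have *: "index_vectors = {0 :: 'a}" by (simp only: index_vectors_def if_False)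
    show ?thesis unfolding * by simp
  qed
  then show "finite (index_vectors :: 'a set)" "index_vectors \<noteq> ({} :: 'a set)" by blast+
qed

typedef (overloaded) ('a::real_vector) basis_index = "index_vectors :: 'a set"
  using index_vectors_nonempty by blast

instance basis_index :: (real_vector) finite
proof
  have "(UNIV :: 'a basis_index set) = Abs_basis_index ` index_vectors"
    by (rule type_definition.Abs_image[OF type_definition_basis_index, symmetric])
  then show "finite (UNIV :: 'a basis_index set)"
    using finite_index_vectors by (metis finite_imageI)
qed

lemma index_vectors_basis:
  assumes "dim (UNIV :: 'a::real_vector set) > 0"
  shows "independent (index_vectors :: 'a set)" "span (index_vectors :: 'a set) = UNIV"
proof -
  obtain B :: "'a set" where B: "independent B" "UNIV \<subseteq> span B" "card B = dim (UNIV :: 'a set)"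
    using basis_exists by blast
  then have "finite_basis B"
    unfolding finite_basis_def using assms card_gt_0_iff[of B] by auto
  then show "independent (index_vectors :: 'a set)" "span (index_vectors :: 'a set) = UNIV"
    using finite_basis_index_vectors[of B] by (simp_all add: finite_basis_def)
qed

lemma card_basis_index:
  assumes "dim (UNIV :: 'a::real_vector set) > 0"
  shows "CARD('a basis_index) = dim (UNIV :: 'a set)"
proof -
  have "CARD('a basis_index) = card (index_vectors :: 'a set)"
    by (rule type_definition.card[OF type_definition_basis_index])
  also have "\<dots> = dim (UNIV :: 'a set)"
    using index_vectors_basis[OF assms] by (metis dim_eq_card_independent dim_span)
  finally show ?thesis .
qed

definition of_basis_coords :: "real ^ 'a basis_index \<Rightarrow> 'a::real_vector"
  where "of_basis_coords w = (\<Sum>i\<in>UNIV. (w $ i) *\<^sub>R Rep_basis_index i)"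

lemma linear_of_basis_coords: "linear of_basis_coords"
  by (intro linearI)
    (simp_all add: of_basis_coords_def scaleR_add_left sum.distrib scaleR_sum_right)

lemma of_basis_coords_eq_0:
  assumes "dim (UNIV :: 'a::real_vector set) > 0" "of_basis_coords w = (0 :: 'a)"
  shows "w = 0"
proof -
  have bij: "bij_betw (Rep_basis_index :: 'a basis_index \<Rightarrow> 'a) UNIV index_vectors"
    using type_definition.Rep_range[OF type_definition_basis_index]
    by (auto simp: bij_betw_def inj_def Rep_basis_index_inject)
  have "(\<Sum>v\<in>index_vectors. (w $ Abs_basis_index v) *\<^sub>R v) = of_basis_coords w"
    unfolding of_basis_coords_def
    by (subst sum.reindex_bij_betw[OF bij, symmetric]) (simp add: Rep_basis_index_inverse)
  then have "w $ Abs_basis_index v = 0" if "v \<in> index_vectors" for v :: 'a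
    using independentD[OF index_vectors_basis(1)[OF assms(1)] finite_index_vectors subset_refl _ that,
        of "\<lambda>v. w $ Abs_basis_index v"] assms(2) by simp
  then show ?thesis
    by (metis Rep_basis_index Rep_basis_index_inverse vec_eq_iff zero_index)
qed

section \<open>Measurable functions on the space of hyperplanes\<close>

definition class_lift :: "(('a::real_normed_vector \<Rightarrow>\<^sub>L real) \<Rightarrow> real \<Rightarrow> real)
    \<Rightarrow> (('a \<Rightarrow>\<^sub>L real) \<times> real) set \<Rightarrow> real"
  where "class_lift \<phi> h = (case SOME p. p \<in> h of (f, y) \<Rightarrow> \<phi> f y)"

lemma class_lift_hyperplane_class:
  assumes "f \<noteq> 0" "\<And>t. t \<noteq> 0 \<Longrightarrow> \<phi> (t *\<^sub>R f) (t * y) = \<phi> f y"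
  shows "class_lift \<phi> (hyperplane_class f y) = \<phi> f y"
proof -
  have "\<exists>p. p \<in> hyperplane_class f y"
    using assms(1) unfolding hyperplane_class_def hyperplane_rel_def
    by (auto intro!: exI[of _ 1])
  then have "(SOME p. p \<in> hyperplane_class f y) \<in> hyperplane_class f y"
    by (rule someI_ex)
  then obtain t where "t \<noteq> 0" "(SOME p. p \<in> hyperplane_class f y) = (t *\<^sub>R f, t * y)"
    unfolding hyperplane_class_def hyperplane_rel_def by auto
  then show ?thesis
    using assms(2) by (simp add: class_lift_def)
qed

lemma hyperplane_space_eq: "hyperplane_space = {hyperplane_class f y | f y. f \<noteq> 0}"
  by (auto simp: hyperplane_space_def hyperplane_class_def quotient_def)

lemma hyperplane_space_Collect:
  assumes "\<And>f y. f \<noteq> 0 \<Longrightarrow> P (hyperplane_class f y) \<longleftrightarrow> Q f y"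
  shows "{h \<in> hyperplane_space. P h} =
    {hyperplane_class f y | f y. hyperplane_class f y \<in> hyperplane_space \<and> Q f y}"
proof -
  have "h \<in> hyperplane_space \<and> P h \<longleftrightarrow> (\<exists>f y. h = hyperplane_class f y \<and> f \<noteq> 0 \<and> Q f y)" for h
    unfolding hyperplane_space_eq using assms by auto
  then show ?thesis
    by (simp add: hyperplane_class_in_space_iff set_eq_iff)
qed

text \<open>By the universal property of the quotient topology the lift is continuous; it is measurable
  since the Borel sets are generated by the open sets.\<close>

lemma class_lift_measurable:
  assumes inv: "\<And>f y t. f \<noteq> 0 \<Longrightarrow> t \<noteq> 0 \<Longrightarrow> \<phi> (t *\<^sub>R f) (t * y) = \<phi> f y"
    and cont: "continuous_on {(f, y). f \<noteq> 0} (\<lambda>(f, y). \<phi> f y)"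
  shows "class_lift \<phi> \<in> borel_measurable (borel_of hyperplane_topology)"
proof -
  have "continuous_on {(f, y). f \<noteq> 0} (class_lift \<phi> \<circ> (\<lambda>(f, y). hyperplane_class f y))"
    using cont by (rule continuous_on_eq) (auto simp: class_lift_hyperplane_class inv)
  then have "continuous_map hyperplane_topology euclideanreal (class_lift \<phi>)"
    by (intro continuous_compose_quotient_map[OF quotient_map_hyperplane_class]) simp
  then have op: "openin hyperplane_topology {h \<in> topspace hyperplane_topology. class_lift \<phi> h \<in> U}" if "open U" for U
    using that by (simp add: openin_continuous_map_preimage)
  have sub: "{U. openin hyperplane_topology U} \<subseteq> Pow (topspace (hyperplane_topology :: (('a \<Rightarrow>\<^sub>L real) \<times> real) set topology))"
    using openin_subset by blast
  show ?thesis
  proof (rule borel_measurableI)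
    fix U :: "real set" assume "open U"
    have "class_lift \<phi> -` U \<inter> space (borel_of hyperplane_topology)
        = {h \<in> topspace hyperplane_topology. class_lift \<phi> h \<in> U}"
      using sub by (auto simp: borel_of_def space_measure_of)
    then show "class_lift \<phi> -` U \<inter> space (borel_of hyperplane_topology) \<in> sets (borel_of hyperplane_topology)"
      using op[OF \<open>open U\<close>] sub by (simp add: borel_of_def)
  qed
qed

lemma space_borel_of: "space (borel_of X) = topspace X"
  unfolding borel_of_def by (rule space_measure_of) (auto dest: openin_subset)

section \<open>A line with a common median\<close>

theorem theorem1:
  fixes m l :: nat
    and \<mu> :: "nat \<Rightarrow> (('a::real_normed_vector \<Rightarrow>\<^sub>L real) \<times> real) set measure"
  assumes "dim (UNIV :: 'a set) = m + 1"
    and "\<And>j. j \<le> l \<Longrightarrow> prob_space (\<mu> j)"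
    and "\<And>j. j \<le> l \<Longrightarrow> sets (\<mu> j) = sets (borel_of hyperplane_topology)"
    and "l \<le> m"
  shows "\<exists>(e :: 'a) x. hopf_class e x \<in> hopf_space \<and>
    (\<forall>j\<le>l.
      measure (\<mu> j) {hyperplane_class f y | f y. hyperplane_class f y \<in> hyperplane_space \<and>
        y * blinfun_apply f e \<ge> x * (blinfun_apply f e)\<^sup>2} \<ge> 1 / 2 \<and>
      measure (\<mu> j) {hyperplane_class f y | f y. hyperplane_class f y \<in> hyperplane_space \<and>
        y * blinfun_apply f e \<le> x * (blinfun_apply f e)\<^sup>2} \<ge> 1 / 2)"
proof -
  let ?J = "of_basis_coords :: real ^ 'a basis_index \<Rightarrow> 'a"
  \<comment> \<open>Dividing both sides of the inequality \<open>y f(e) \<ge> x f(e)^2\<close> by the square of the norm of \<open>f\<close> makes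
    each side depend only on the class of \<open>(f, y)\<close>.\<close>
  define \<alpha> :: "'a \<Rightarrow> ('a \<Rightarrow>\<^sub>L real) \<Rightarrow> real \<Rightarrow> real"
    where "\<alpha> e f y = (y * blinfun_apply f e) / (norm f)\<^sup>2" for e f y
  define \<beta> :: "'a \<Rightarrow> ('a \<Rightarrow>\<^sub>L real) \<Rightarrow> real \<Rightarrow> real"
    where "\<beta> e f y = (blinfun_apply f e)\<^sup>2 / (norm f)\<^sup>2" for e f y
  have inv: "\<alpha> e (t *\<^sub>R f) (t * y) = \<alpha> e f y" "\<beta> e (t *\<^sub>R f) (t * y) = \<beta> e f y" if "t \<noteq> 0" for e f y t
  proof -
    have eq: "t * y * (t * blinfun_apply f e) = t\<^sup>2 * (y * blinfun_apply f e)"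
      by (simp add: power2_eq_square)
    show "\<alpha> e (t *\<^sub>R f) (t * y) = \<alpha> e f y" "\<beta> e (t *\<^sub>R f) (t * y) = \<beta> e f y"
      using that by (simp_all add: \<alpha>_def \<beta>_def scaleR_blinfun.rep_eq power_mult_distrib eq)
  qed
  define A where "A w = class_lift (\<alpha> (?J w))" for w
  define B where "B w = class_lift (\<beta> (?J w))" for w
  have A_class: "A w (hyperplane_class f y) = \<alpha> (?J w) f y"
    and B_class: "B w (hyperplane_class f y) = \<beta> (?J w) f y" if "f \<noteq> 0" for w f y
    using that by (simp_all add: A_def B_def class_lift_hyperplane_class inv)
  have dim: "dim (UNIV :: 'a set) > 0" using assms(1) by simp
  have space: "space (\<mu> j) = hyperplane_space" if "j \<le> l" for j
    using sets_eq_imp_space_eq[OF assms(3)[OF that]]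
    by (simp add: space_borel_of topspace_hyperplane_topology)
  have "bounded_linear ?J"
    using linear_of_basis_coords by (rule linear_conv_bounded_linear[THEN iffD1])
  then have J_cont: "continuous_on UNIV ?J"
    by (rule linear_continuous_on)
  interpret odd_quotient_family \<mu> "Suc l" A B
  proof (rule odd_quotient_family.intro)
    show "Suc l \<le> DIM(real ^ 'a basis_index)"
      using assms(1,4) card_basis_index[OF dim] by simp
    show "A w \<in> borel_measurable (\<mu> j)" "B w \<in> borel_measurable (\<mu> j)" if "j < Suc l" for j w
    proof -
      have "continuous_on {(f, y). f \<noteq> 0} (\<lambda>(f, y). \<alpha> (?J w) f y)"
        "continuous_on {(f, y). f \<noteq> 0} (\<lambda>(f, y). \<beta> (?J w) f y)"
        unfolding \<alpha>_def \<beta>_def case_prod_unfold by (auto intro!: continuous_intros)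
      then have "A w \<in> borel_measurable (borel_of hyperplane_topology)"
        "B w \<in> borel_measurable (borel_of hyperplane_topology)"
        unfolding A_def B_def by (auto intro!: class_lift_measurable inv)
      then show "A w \<in> borel_measurable (\<mu> j)" "B w \<in> borel_measurable (\<mu> j)"
        using measurable_cong_sets[OF assms(3)[of j] refl] that by auto
    qed
    show "continuous_on UNIV (\<lambda>w. A w h)" "continuous_on UNIV (\<lambda>w. B w h)"
      if "j < Suc l" "h \<in> space (\<mu> j)" for j h
    proof -
      obtain f y where h: "f \<noteq> 0" "h = hyperplane_class f y"
        using \<open>h \<in> space (\<mu> j)\<close> space[of j] \<open>j < Suc l\<close> by (auto simp: hyperplane_space_eq)
      show "continuous_on UNIV (\<lambda>w. A w h)" "continuous_on UNIV (\<lambda>w. B w h)"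
        unfolding h(2) A_class[OF h(1)] B_class[OF h(1)] \<alpha>_def \<beta>_def
        using h(1) by (auto intro!: continuous_intros J_cont)
    qed
    have J_minus: "?J (- w) = - ?J w" for w
      using linear_of_basis_coords by (rule linear_neg)
    show "A (- w) h = - A w h" "B (- w) h = B w h" "B w h \<ge> 0" for w h
      by (simp_all add: A_def B_def class_lift_def \<alpha>_def \<beta>_def J_minus blinfun.minus_right
          split: prod.split)
    show "A w h = 0" if "B w h = 0" for w h
      using that by (auto simp: A_def B_def class_lift_def \<alpha>_def \<beta>_def split: prod.splits)
    show "prob_space (\<mu> j)" if "j < Suc l" for j
      using that by (intro assms(2)) simp
  qed simp
  obtain w x where w: "w \<noteq> 0"
    "\<And>j. j < Suc l \<Longrightarrow> measure (\<mu> j) {h \<in> space (\<mu> j). A w h \<ge> x * B w h} \<ge> 1 / 2"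
    "\<And>j. j < Suc l \<Longrightarrow> measure (\<mu> j) {h \<in> space (\<mu> j). A w h \<le> x * B w h} \<ge> 1 / 2"
    using exists_common_median by blast
  have "?J w \<noteq> 0"
    using of_basis_coords_eq_0[OF dim] w(1) by blast
  moreover have "{h \<in> hyperplane_space. A w h \<ge> x * B w h} =
      {hyperplane_class f y | f y. hyperplane_class f y \<in> hyperplane_space \<and>
        y * blinfun_apply f (?J w) \<ge> x * (blinfun_apply f (?J w))\<^sup>2}"
    "{h \<in> hyperplane_space. A w h \<le> x * B w h} =
      {hyperplane_class f y | f y. hyperplane_class f y \<in> hyperplane_space \<and>
        y * blinfun_apply f (?J w) \<le> x * (blinfun_apply f (?J w))\<^sup>2}"
  proof -
    have cancel: "x * (b / c) \<le> a / c \<longleftrightarrow> x * b \<le> a" "a / c \<le> x * (b / c) \<longleftrightarrow> a \<le> x * b"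
      if "c > 0" for a b c :: real
      using that by (simp_all add: divide_le_cancel)
    have *: "x * B w (hyperplane_class f y) \<le> A w (hyperplane_class f y) \<longleftrightarrow>
        x * (blinfun_apply f (?J w))\<^sup>2 \<le> y * blinfun_apply f (?J w)"
      "A w (hyperplane_class f y) \<le> x * B w (hyperplane_class f y) \<longleftrightarrow>
        y * blinfun_apply f (?J w) \<le> x * (blinfun_apply f (?J w))\<^sup>2" if "f \<noteq> 0" for f y
      unfolding A_class[OF that] B_class[OF that] \<alpha>_def \<beta>_def using that
      by (intro cancel; simp)+
    show "{h \<in> hyperplane_space. A w h \<ge> x * B w h} =
      {hyperplane_class f y | f y. hyperplane_class f y \<in> hyperplane_space \<and>
        y * blinfun_apply f (?J w) \<ge> x * (blinfun_apply f (?J w))\<^sup>2}"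
      by (rule hyperplane_space_Collect) (rule *(1))
    show "{h \<in> hyperplane_space. A w h \<le> x * B w h} =
      {hyperplane_class f y | f y. hyperplane_class f y \<in> hyperplane_space \<and>
        y * blinfun_apply f (?J w) \<le> x * (blinfun_apply f (?J w))\<^sup>2}"
      by (rule hyperplane_space_Collect) (rule *(2))
  qed
  ultimately show ?thesis
    using w(2,3) space by (intro exI[of _ "?J w"] exI[of _ x]) (auto simp: hopf_class_in_space_iff)
qed

end
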